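(* For any $3\times 3$ complex matrix $A$, there exist an inner function $\theta$ and $g_1,g_2\in L^\infty(\mathbb{T})$ such that $W(A)=W(A_{g_1}^\theta\oplus A_{g_2}^\theta)$ (summands may be $0$).
   Context: For a linear operator $T$ on a complex Hilbert space, $W(T)=\{\langle Tx,x\rangle:\langle x,x\rangle=1\}$ is its numerical range; matrices act on Euclidean $\mathbb{C}^n$. $H^2$ is the Hardy space of analytic functions on the open unit disc $\mathbb{D}$ with square summable Taylor coefficients, identified via radial boundary values with the closed subspace of $L^2(\mathbb{T})$, $\mathbb{T}=\partial\mathbb{D}$, of functions whose negative Fourier coefficients vanish. A function $\theta\in H^2$ is inner if $|\theta|=1$ a.e. on $\mathbb{T}$; its model space is $K_\theta^2=(\theta H^2)^{\perp}\cap H^2$. For $g\in L^\infty(\mathbb{T})$ the truncated Toeplitz operator with symbol $g$ is $A_g^\theta:K_\theta^2\to K_\theta^2$, $A_g^\theta(f)=P_\theta(gf)$, where $P_\theta$ is the orthogonal projection $L^2(\mathbb{T})\to K_\theta^2$. $A_{g_1}^\theta\oplus A_{g_2}^\theta$ is the orthogonal direct sum acting on $K_\theta^2\oplus K_\theta^2$. "Summands may be $0$" is understood as: one of the two summands is allowed to be absent. *)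

theory Defs
  imports "HOL-Complex_Analysis.Complex_Analysis"
begin

text \<open>
  Vector spaces are given by a carrier set together with an inner product (linear in the first
  argument), so that the same notion of numerical range applies to matrices, to operators on
  subspaces of \<open>L\<^sup>2\<close> of the circle, and to direct sums of such operators.
\<close>

definition numerical_range ::
  "'v set \<Rightarrow> ('v \<Rightarrow> 'v \<Rightarrow> complex) \<Rightarrow> ('v \<Rightarrow> 'v) \<Rightarrow> complex set" where
  "numerical_range V ip T = {ip (T x) x | x. x \<in> V \<and> ip x x = 1}"

definition cvec_inner :: "complex ^ 'n \<Rightarrow> complex ^ 'n \<Rightarrow> complex" where
  "cvec_inner x y = (\<Sum>i\<in>UNIV. x $ i * cnj (y $ i))"

definition matrix_numerical_range :: "complex ^ 'n ^ 'n \<Rightarrow> complex set" where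
  "matrix_numerical_range A = numerical_range UNIV cvec_inner (\<lambda>x. A *v x)"

definition sum_inner ::
  "('v \<Rightarrow> 'v \<Rightarrow> complex) \<Rightarrow> ('w \<Rightarrow> 'w \<Rightarrow> complex) \<Rightarrow> 'v \<times> 'w \<Rightarrow> 'v \<times> 'w \<Rightarrow> complex" where
  "sum_inner ip1 ip2 x y = ip1 (fst x) (fst y) + ip2 (snd x) (snd y)"


text \<open>
  Normalized arc length on the unit circle, as a probability measure on the Borel sets of the
  complex plane that is concentrated on the circle. Elements of \<open>L\<^sup>2\<close> and \<open>L\<^sup>\<infinity>\<close> are represented by
  functions on the plane; only their values almost everywhere on the circle matter, and functions
  that agree there represent the same element.
\<close>

definition circle_measure :: "complex measure" where
  "circle_measure = distr (uniform_measure lborel {0..<2 * pi}) borel cis"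

definition L2_circle :: "(complex \<Rightarrow> complex) set" where
  "L2_circle = {f. f \<in> borel_measurable circle_measure \<and>
                   integrable circle_measure (\<lambda>z. (cmod (f z))\<^sup>2)}"

definition Linf_circle :: "(complex \<Rightarrow> complex) set" where
  "Linf_circle = {g. g \<in> borel_measurable circle_measure \<and>
                     (\<exists>C. AE z in circle_measure. cmod (g z) \<le> C)}"

definition L2_inner :: "(complex \<Rightarrow> complex) \<Rightarrow> (complex \<Rightarrow> complex) \<Rightarrow> complex" where
  "L2_inner f h = (LINT z|circle_measure. f z * cnj (h z))"

definition L2_orth :: "(complex \<Rightarrow> complex) set \<Rightarrow> (complex \<Rightarrow> complex) set" where
  "L2_orth S = {f \<in> L2_circle. \<forall>h\<in>S. L2_inner f h = 0}"

text \<open>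
  A representative of the orthogonal projection of \<open>f\<close> onto \<open>K\<close>; for a closed
  subspace \<open>K\<close> it exists and is unique up to equality almost everywhere on the circle.
\<close>

definition L2_proj :: "(complex \<Rightarrow> complex) set \<Rightarrow> (complex \<Rightarrow> complex) \<Rightarrow> (complex \<Rightarrow> complex)" where
  "L2_proj K f = (SOME p. p \<in> K \<and> (\<forall>k\<in>K. L2_inner (\<lambda>z. f z - p z) k = 0))"


definition hardy_disc :: "(complex \<Rightarrow> complex) set" where
  "hardy_disc = {F. F holomorphic_on ball 0 1 \<and>
                    summable (\<lambda>n. (cmod ((deriv ^^ n) F 0 / fact n))\<^sup>2)}"

text \<open>
  The Hardy space as a subspace of \<open>L\<^sup>2\<close> of the circle: the radial boundary functions of the
  elements of \<^const>\<open>hardy_disc\<close>.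
\<close>

definition hardy_circle :: "(complex \<Rightarrow> complex) set" where
  "hardy_circle = {f \<in> L2_circle. \<exists>F\<in>hardy_disc.
     AE z in circle_measure. ((\<lambda>r. F (complex_of_real r * z)) \<longlongrightarrow> f z) (at_left 1)}"

definition inner_function :: "(complex \<Rightarrow> complex) \<Rightarrow> bool" where
  "inner_function \<theta> \<longleftrightarrow> \<theta> \<in> hardy_circle \<and> (AE z in circle_measure. cmod (\<theta> z) = 1)"

definition model_space :: "(complex \<Rightarrow> complex) \<Rightarrow> (complex \<Rightarrow> complex) set" where
  "model_space \<theta> = L2_orth ((\<lambda>h z. \<theta> z * h z) ` hardy_circle) \<inter> hardy_circle"

definition trunc_toeplitz ::
  "(complex \<Rightarrow> complex) \<Rightarrow> (complex \<Rightarrow> complex) \<Rightarrow> (complex \<Rightarrow> complex) \<Rightarrow> (complex \<Rightarrow> complex)" where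
  "trunc_toeplitz \<theta> g f = L2_proj (model_space \<theta>) (\<lambda>z. g z * f z)"

definition tto_numerical_range :: "(complex \<Rightarrow> complex) \<Rightarrow> (complex \<Rightarrow> complex) \<Rightarrow> complex set" where
  "tto_numerical_range \<theta> g = numerical_range (model_space \<theta>) L2_inner (trunc_toeplitz \<theta> g)"

definition tto_sum_numerical_range ::
  "(complex \<Rightarrow> complex) \<Rightarrow> (complex \<Rightarrow> complex) \<Rightarrow> (complex \<Rightarrow> complex) \<Rightarrow> complex set" where
  "tto_sum_numerical_range \<theta> g1 g2 =
     numerical_range (model_space \<theta> \<times> model_space \<theta>) (sum_inner L2_inner L2_inner)
       (map_prod (trunc_toeplitz \<theta> g1) (trunc_toeplitz \<theta> g2))"

end

theory Submission
  imports Defs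
begin

text \<open>
  The inner function \<open>\<theta>(z) = z\<^sup>3\<close> suffices: its model space consists of the polynomials of degree at
  most two, and the truncated Toeplitz operators on it are the \<open>3 \<times> 3\<close> Toeplitz matrices. So one has
  to find a Toeplitz matrix with the same numerical range as \<open>A\<close>.

  The numerical range is compact and convex, hence determined by the largest eigenvalues of the
  Hermitian parts of \<open>w A\<close>, and so by the determinants \<open>det (\<mu> - (w A + (w A)\<^sup>*))\<close>. After
  diagonalizing \<open>A + A\<^sup>*\<close>, these depend on the off-diagonal entries \<open>k\<^sub>1, k\<^sub>2, k\<^sub>3\<close> only through the
  \<open>|k\<^sub>i|\<^sup>2\<close> and \<open>Re (k\<^sub>1 k\<^sub>2 k\<^sub>3)\<close>; an intermediate value argument replaces the \<open>k\<^sub>i\<close> by real numbers, so that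
  \<open>A\<close> becomes a symmetric matrix \<open>B\<close>. A second intermediate value argument gives a real unit vector
  \<open>u\<close> with \<open>\<langle>B u, u\<rangle> = tr B / 3\<close>. Completing \<open>u\<close> to a real orthonormal basis \<open>x, u, y\<close>, the matrix of
  \<open>B\<close> with respect to \<open>(x - i y) / \<surd>2, u, (x + i y) / \<surd>2\<close> is Toeplitz.
\<close>

no_notation fps_nth (infixl "$" 75)

section \<open>Fourier coefficients on the circle\<close>

lemma space_circle_measure [simp]: "space circle_measure = UNIV"
  and sets_circle_measure [simp, measurable_cong]: "sets circle_measure = sets borel"
  by (simp_all add: circle_measure_def)

lemma borel_measurable_cis [measurable]: "cis \<in> borel_measurable borel"
  by (intro borel_measurable_continuous_onI continuous_intros)

lemma uniform_arc:
  "uniform_measure lborel {0..<2 * pi} = density lborel (\<lambda>x. ennreal (indicator {0..<2 * pi} x / (2 * pi)))"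
proof -
  have "indicator {0..<2 * pi} x / emeasure lborel {0..<2 * pi} =
      ennreal (indicator {0..<2 * pi} x / (2 * pi))" for x :: real
    by (simp add: divide_ennreal[symmetric] ennreal_indicator ennreal_mult)
  then show ?thesis by (simp add: uniform_measure_def)
qed

lemma emeasure_circle_space: "emeasure circle_measure UNIV = 1"
  unfolding circle_measure_def
  by (subst emeasure_distr) (auto simp: ennreal_divide_self)

lemma finite_measure_circle [simp, intro]: "finite_measure circle_measure"
  by (rule finite_measureI) (simp add: emeasure_circle_space)

lemma AE_circle_norm: "AE z in circle_measure. cmod z = 1"
  unfolding circle_measure_def by (subst AE_distr_iff) auto

lemma circle_integral_conv:
  fixes f :: "complex \<Rightarrow> complex"
  assumes [measurable]: "f \<in> borel_measurable borel"
  shows "(LINT z|circle_measure. f z) = (LINT x|lborel. indicator {0..<2*pi} x *\<^sub>R f (cis x)) / (2 * pi)"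
proof -
  have "(LINT z|circle_measure. f z) =
      (LINT x|lborel. (indicator {0..<2*pi} x / (2 * pi)) *\<^sub>R f (cis x))"
    unfolding circle_measure_def uniform_arc
    by (subst integral_distr, simp, simp, subst integral_density) simp_all
  also have "\<dots> = (LINT x|lborel. (indicator {0..<2*pi} x *\<^sub>R f (cis x)) / complex_of_real (2 * pi))"
    by (intro Bochner_Integration.integral_cong refl) (simp add: indicator_def scaleR_conv_of_real)
  finally show ?thesis by (simp only: integral_divide_zero)
qed

text \<open>The function may be unbounded on the plane, but the measure sees only the compact unit
  circle.\<close>

lemma AE_bounded_continuous:
  fixes f :: "complex \<Rightarrow> complex"
  assumes "continuous_on UNIV f"
  shows "\<exists>B. AE z in circle_measure. cmod (f z) \<le> B"
proof -
  have "compact (f ` sphere 0 1)"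
    by (intro compact_continuous_image continuous_on_subset[OF assms]) auto
  then obtain B where "\<And>z. z \<in> sphere 0 1 \<Longrightarrow> cmod (f z) \<le> B"
    using compact_imp_bounded bounded_iff by (metis image_eqI)
  then have "AE z in circle_measure. cmod (f z) \<le> B"
    by (intro eventually_mono[OF AE_circle_norm]) auto
  then show ?thesis ..
qed

lemma integrable_circle_continuous:
  fixes f :: "complex \<Rightarrow> complex"
  assumes "continuous_on UNIV f"
  shows "integrable circle_measure f"
  using AE_bounded_continuous[OF assms] borel_measurable_continuous_onI[OF assms]
  by (auto intro!: finite_measure.integrable_const_bound
      simp: measurable_cong_sets[OF sets_circle_measure refl])

text \<open>On the circle the integrand is \<open>cis (k * x)\<close> with \<open>k = m - n\<close>;
  for \<open>k \<noteq> 0\<close> its antiderivative \<open>cis (k * x) / (\<i> * k)\<close> takes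
  equal values at both ends of a period.\<close>

lemma circle_moment:
  "(LINT z|circle_measure. z ^ m * cnj z ^ n) = (if m = n then 1 else 0)"
proof -
  define k :: real where "k = real m - real n"
  have pw: "cis x ^ m * cnj (cis x) ^ n = cis (k * x)" for x
    unfolding cis_cnj Complex.DeMoivre cis_mult k_def
    by (rule arg_cong[of _ _ cis]) (simp add: algebra_simps)
  have "(LINT z|circle_measure. z ^ m * cnj z ^ n) =
      (LINT x|lborel. indicator {0..<2*pi} x *\<^sub>R cis (k * x)) / (2 * pi)"
    using circle_integral_conv[of "\<lambda>z. z ^ m * cnj z ^ n"] unfolding pw
    by (simp add: borel_measurable_continuous_onI continuous_intros)
  \<comment> \<open>The fundamental theorem of calculus is applied on a closed interval; the added
    endpoint is a null set.\<close>
  also have "(LINT x|lborel. indicator {0..<2*pi} x *\<^sub>R cis (k * x)) =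
      (LINT x|lborel. indicator {0..2*pi} x *\<^sub>R cis (k * x))"
  proof (rule integral_cong_AE)
    show "AE x in lborel. indicator {0..<2*pi} x *\<^sub>R cis (k * x) = indicator {0..2*pi} x *\<^sub>R cis (k * x)"
      using AE_lborel_singleton[of "2*pi"] by eventually_elim (auto simp: indicator_def)
  qed (rule borel_measurable_continuous_onI borel_measurable_scaleR borel_measurable_indicator continuous_intros | simp)+
  also have "\<dots> = (if m = n then 2 * pi else 0)"
  proof (cases "m = n")
    case True
    then have "k = 0" by (simp add: k_def)
    then show ?thesis using True by (simp add: scaleR_conv_of_real)
  next
    case False
    then have "k \<noteq> 0" by (simp add: k_def)
    have "has_bochner_integral lborel (\<lambda>x. indicator {0..2*pi} x *\<^sub>R cis (k * x))
        (cis (k * (2*pi)) / (\<i> * k) - cis (k * 0) / (\<i> * k))"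
    proof (rule has_bochner_integral_FTC_Icc)
      fix x :: real
      have "((\<lambda>x. cis (k * x)) has_vector_derivative (\<i> * k * cis (k * x))) (at x within {0..2 * pi})"
      proof -
        have "((\<lambda>z. exp (\<i> * k * z)) has_field_derivative (\<i> * k * exp (\<i> * k * of_real x))) (at (of_real x))"
          by (auto intro!: derivative_eq_intros)
        from has_vector_derivative_real_field[OF this] show ?thesis
          by (simp add: cis_conv_exp mult_ac)
      qed
      moreover have "\<i> * k * cis (k * x) * inverse (\<i> * k) = cis (k * x)"
        using \<open>k \<noteq> 0\<close> by (simp add: field_simps)
      ultimately
      show "((\<lambda>x. cis (k * x) / (\<i> * k)) has_vector_derivative cis (k * x)) (at x within {0..2 * pi})"
        using has_vector_derivative_mult_left[of "\<lambda>x. cis (k * x)" _ _ "inverse (\<i> * k)"]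
        unfolding divide_inverse by metis
    next
      show "continuous_on {0..2*pi} (\<lambda>x. cis (k * x))"
        by (intro continuous_intros)
    qed simp
    moreover have "cis (k * (2*pi)) = 1"
      using cis_multiple_2pi[of "real_of_int (int m - int n)"] by (simp add: k_def mult_ac)
    ultimately show ?thesis using False
      by (simp add: has_bochner_integral_integral_eq)
  qed
  finally show ?thesis by simp
qed

section \<open>Parseval's identity for polynomials and the tail estimate for Hardy functions\<close>

lemma nn_integral_le_limit:
  fixes u :: "nat \<Rightarrow> 'a \<Rightarrow> ennreal"
  assumes [measurable]: "\<And>k. u k \<in> borel_measurable M"
    and lim: "AE x in M. (\<lambda>k. u k x) \<longlonglongrightarrow> w x"
    and le: "\<And>k. (\<integral>\<^sup>+x. u k x \<partial>M) \<le> C"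
  shows "(\<integral>\<^sup>+x. w x \<partial>M) \<le> C"
proof -
  have "(\<integral>\<^sup>+x. w x \<partial>M) \<le> (\<integral>\<^sup>+x. liminf (\<lambda>k. u k x) \<partial>M)"
    using lim by (intro nn_integral_mono_AE) (auto elim!: eventually_mono simp: lim_imp_Liminf)
  also have "\<dots> \<le> liminf (\<lambda>k. \<integral>\<^sup>+x. u k x \<partial>M)"
    by (intro nn_integral_liminf) auto
  also have "\<dots> \<le> C"
    using le by (intro Liminf_le) auto
  finally show ?thesis .
qed

text \<open>Parseval's identity: the double sum for \<open>p * cnj p\<close> collapses to its
  diagonal by orthonormality of the monomials.\<close>

lemma circle_polynomial_norm:
  "(\<integral>\<^sup>+z. (cmod (\<Sum>n<N. b n * z ^ n))\<^sup>2 \<partial>circle_measure) = ennreal (\<Sum>n<N. (cmod (b n))\<^sup>2)"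
proof -
  let ?p = "\<lambda>z. \<Sum>n<N. b n * z ^ n"
  have int: "integrable circle_measure (\<lambda>z. complex_of_real ((cmod (?p z))\<^sup>2))"
    by (intro integrable_circle_continuous continuous_intros)
  then have "(\<integral>\<^sup>+z. (cmod (?p z))\<^sup>2 \<partial>circle_measure) = ennreal (LINT z|circle_measure. (cmod (?p z))\<^sup>2)"
    by (intro nn_integral_eq_integral) (simp_all only: complex_of_real_integrable_eq, simp)
  moreover have "complex_of_real (LINT z|circle_measure. (cmod (?p z))\<^sup>2) = of_real (\<Sum>n<N. (cmod (b n))\<^sup>2)"
  proof -
    have "complex_of_real (LINT z|circle_measure. (cmod (?p z))\<^sup>2) =
        (LINT z|circle_measure. (\<Sum>n<N. \<Sum>m<N. (b n * cnj (b m)) * (z ^ n * cnj z ^ m)))"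
    proof -
      have "complex_of_real ((cmod (?p z))\<^sup>2) = (\<Sum>n<N. \<Sum>m<N. (b n * cnj (b m)) * (z ^ n * cnj z ^ m))" for z
        unfolding complex_norm_square cnj_sum sum_product
        by (intro sum.cong refl) (simp add: mult_ac)
      then show ?thesis by (simp only: integral_complex_of_real[symmetric])
    qed
    also have "\<dots> = (\<Sum>n<N. \<Sum>m<N. (b n * cnj (b m)) * (LINT z|circle_measure. z ^ n * cnj z ^ m))"
    proof -
      have "integrable circle_measure (\<lambda>z. (b n * cnj (b m)) * (z ^ n * cnj z ^ m))" for n m
        by (intro integrable_circle_continuous continuous_intros)
      then show ?thesis
        by (subst Bochner_Integration.integral_sum, force intro: Bochner_Integration.integrable_sum,
            subst Bochner_Integration.integral_sum, blast, simp only: integral_mult_right_zero)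
    qed
    also have "\<dots> = (\<Sum>n<N. b n * cnj (b n))"
      by (simp add: circle_moment if_distrib cong: if_cong)
    finally show ?thesis by (simp add: complex_norm_square del: of_real_power)
  qed
  ultimately show ?thesis by (simp only: of_real_eq_iff)
qed

text \<open>Fatou's lemma, once for the partial sums at a fixed radius and once for the radius tending to \<open>1\<close>.\<close>

lemma hardy_circle_tail:
  assumes F: "F \<in> hardy_disc"
    and lim: "AE z in circle_measure. ((\<lambda>r. F (complex_of_real r * z)) \<longlongrightarrow> f z) (at_left 1)"
  defines "a \<equiv> \<lambda>n. (deriv ^^ n) F 0 / fact n"
  shows "(\<integral>\<^sup>+z. (cmod (f z - (\<Sum>n<N. a n * z ^ n)))\<^sup>2 \<partial>circle_measure) \<le> ennreal (\<Sum>n. (cmod (a (n + N)))\<^sup>2)"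
proof -
  have hol: "F holomorphic_on ball 0 1" and summ: "summable (\<lambda>n. (cmod (a n))\<^sup>2)"
    using F by (auto simp: hardy_disc_def a_def)
  have sums: "(\<lambda>n. a n * w ^ n) sums F w" if "cmod w < 1" for w
    using holomorphic_power_series[OF hol, of w] that by (simp add: a_def)
  define S where "S = (\<lambda>z. \<Sum>n<N. a n * z ^ n)"
  \<comment> \<open>The power series stands here instead of \<open>F\<close>, which is arbitrary
    outside the disc: a series of measurable functions has a measurable sum on the whole
    plane.\<close>
  have disc: "(\<integral>\<^sup>+z. (cmod ((\<Sum>n. a n * (of_real s * z) ^ n) - S (of_real s * z)))\<^sup>2 \<partial>circle_measure)
      \<le> ennreal (\<Sum>n. (cmod (a (n + N)))\<^sup>2)" if s: "0 \<le> s" "s < 1" for s :: real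
  proof (rule nn_integral_le_limit)
    \<comment> \<open>Coefficients of the dilated function with the first \<open>N\<close> terms
      removed; the dilation by \<open>s\<close> is absorbed into them, so that Parseval's identity
      applies to the partial sums in \<open>z\<close>.\<close>
    define c where "c = (\<lambda>n. if n < N then 0 else a n * of_real s ^ n)"
    let ?u = "\<lambda>M z. ennreal ((cmod (\<Sum>n<M. c n * z ^ n))\<^sup>2)"
    show "AE z in circle_measure. (\<lambda>M. ?u M z) \<longlonglongrightarrow>
        ennreal ((cmod ((\<Sum>n. a n * (of_real s * z) ^ n) - S (of_real s * z)))\<^sup>2)"
      using AE_circle_norm
    proof eventually_elim
      case (elim z)
      let ?w = "complex_of_real s * z"
      have "cmod ?w < 1" using elim s by (simp add: norm_mult)
      then have 1: "(\<lambda>n. a n * ?w ^ n) sums (\<Sum>n. a n * ?w ^ n)"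
        using sums sums_unique by metis
      have 2: "(\<lambda>n. if n < N then a n * ?w ^ n else 0) sums S ?w"
        using sums_If_finite_set[of "{..<N}" "\<lambda>n. a n * ?w ^ n"] by (simp add: S_def)
      have "(\<lambda>n. c n * z ^ n) sums ((\<Sum>n. a n * ?w ^ n) - S ?w)"
        using sums_diff[OF 1 2] by (rule sums_cong[THEN iffD1, rotated])
          (simp add: c_def power_mult_distrib mult_ac)
      then show ?case
        unfolding sums_def by (intro tendsto_intros tendsto_ennrealI)
    qed
    show "integral\<^sup>N circle_measure (?u M) \<le> ennreal (\<Sum>n. (cmod (a (n + N)))\<^sup>2)" for M
    proof -
      \<comment> \<open>Summing up to \<open>N + M\<close> allows a shift of the index by
        \<open>N\<close>, since the first \<open>N\<close> terms vanish; the powers of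
        \<open>s\<close> are then bounded by 1.\<close>
      have "(\<Sum>n<M. (cmod (c n))\<^sup>2) \<le> (\<Sum>n<N + M. (cmod (c n))\<^sup>2)"
        by (intro sum_mono2) auto
      also have "\<dots> = (\<Sum>n<M. (cmod (c (n + N)))\<^sup>2)"
        by (induction M) (auto simp: c_def add_ac)
      also have "\<dots> \<le> (\<Sum>n<M. (cmod (a (n + N)))\<^sup>2)"
        using s by (intro sum_mono power_mono)
          (auto simp: c_def norm_mult norm_power intro!: mult_left_le power_le_one)
      also have "\<dots> \<le> (\<Sum>n. (cmod (a (n + N)))\<^sup>2)"
        using summable_ignore_initial_segment[OF summ, of N] by (intro sum_le_suminf) auto
      finally show ?thesis
        by (simp only: circle_polynomial_norm ennreal_leI)
    qed
  qed auto
  \<comment> \<open>Fatou's lemma speaks of sequences, so the radius runs through a sequence tending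
    to 1 from the left.\<close>
  define s where "s = (\<lambda>k. 1 - 1 / real (Suc k))"
  have s: "0 \<le> s k" "s k < 1" for k by (auto simp: s_def)
  have "s \<longlonglongrightarrow> 1 - 0"
    unfolding s_def by (intro tendsto_intros LIMSEQ_Suc lim_1_over_n)
  then have s_lim: "filterlim s (at_left 1) sequentially"
    using s by (auto simp: filterlim_at less_imp_neq)
  show ?thesis
  proof (rule nn_integral_le_limit)
    let ?u = "\<lambda>k z. ennreal ((cmod ((\<Sum>n. a n * (of_real (s k) * z) ^ n) - S (of_real (s k) * z)))\<^sup>2)"
    show "AE z in circle_measure. (\<lambda>k. ?u k z) \<longlonglongrightarrow> ennreal ((cmod (f z - (\<Sum>n<N. a n * z ^ n)))\<^sup>2)"
      using lim AE_circle_norm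
    proof eventually_elim
      case (elim z)
      have "(\<Sum>n. a n * (of_real (s k) * z) ^ n) = F (of_real (s k) * z)" for k
        using sums[of "of_real (s k) * z"] elim s[of k] by (simp add: norm_mult sums_iff)
      moreover have "(\<lambda>k. F (of_real (s k) * z)) \<longlonglongrightarrow> f z"
        using filterlim_compose[OF elim(1) s_lim] by simp
      moreover have "(\<lambda>k. S (of_real (s k) * z)) \<longlonglongrightarrow> S (of_real 1 * z)"
        unfolding S_def using \<open>s \<longlonglongrightarrow> 1 - 0\<close> by (intro tendsto_intros) auto
      ultimately have "(\<lambda>k. (\<Sum>n. a n * (of_real (s k) * z) ^ n) - S (of_real (s k) * z)) \<longlonglongrightarrow> f z - S (of_real 1 * z)"
        by (simp only: tendsto_diff)
      then have "(\<lambda>k. ?u k z) \<longlonglongrightarrow> ennreal ((cmod (f z - S (of_real 1 * z)))\<^sup>2)"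
        by (intro tendsto_ennrealI tendsto_power tendsto_norm)
      then show ?case by (simp add: S_def)
    qed
    show "integral\<^sup>N circle_measure (?u k) \<le> ennreal (\<Sum>n. (cmod (a (n + N)))\<^sup>2)" for k
      using disc s by simp
  next
    show "(\<lambda>z. ennreal ((cmod ((\<Sum>n. a n * (of_real (s k) * z) ^ n) - S (of_real (s k) * z)))\<^sup>2)) \<in> borel_measurable circle_measure" for k
      by (simp add: S_def)
  qed
qed

section \<open>Square integrable functions on the circle\<close>

lemma L2_circle_iff:
  "f \<in> L2_circle \<longleftrightarrow> f \<in> borel_measurable borel \<and> integrable circle_measure (\<lambda>z. (cmod (f z))\<^sup>2)"
  by (simp add: L2_circle_def measurable_cong_sets[OF sets_circle_measure refl])

lemma integrable_L2_mult:
  assumes "f \<in> L2_circle" "h \<in> L2_circle"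
  shows "integrable circle_measure (\<lambda>z. f z * h z)"
proof (rule Bochner_Integration.integrable_bound)
  show "integrable circle_measure (\<lambda>z. (cmod (f z))\<^sup>2 + (cmod (h z))\<^sup>2)"
    using assms by (simp add: L2_circle_iff)
  show "(\<lambda>z. f z * h z) \<in> borel_measurable circle_measure"
    using assms by (auto simp: L2_circle_iff)
  have "cmod (f z * h z) \<le> (cmod (f z))\<^sup>2 + (cmod (h z))\<^sup>2" for z
    using sum_squares_bound[of "cmod (f z)" "cmod (h z)"]
      mult_nonneg_nonneg[OF norm_ge_zero[of "f z"] norm_ge_zero[of "h z"]]
    unfolding norm_mult by linarith
  then show "AE z in circle_measure. cmod (f z * h z) \<le> norm ((cmod (f z))\<^sup>2 + (cmod (h z))\<^sup>2)"
    by (simp add: order.trans[OF _ abs_ge_self])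
qed

lemma L2_circle_AE_bounded:
  assumes "f \<in> borel_measurable borel" "AE z in circle_measure. cmod (f z) \<le> B"
  shows "f \<in> L2_circle"
proof -
  have "AE z in circle_measure. norm ((cmod (f z))\<^sup>2) \<le> B\<^sup>2"
    using assms(2) by (rule eventually_mono) (simp add: power_mono)
  then show ?thesis
    using assms(1) by (auto simp: L2_circle_iff intro!: finite_measure.integrable_const_bound)
qed

lemma L2_circle_continuous:
  assumes "continuous_on UNIV f"
  shows "f \<in> L2_circle"
  using AE_bounded_continuous[OF assms] borel_measurable_continuous_onI[OF assms]
  by (auto intro: L2_circle_AE_bounded)

lemma L2_circle_cnj: "f \<in> L2_circle \<Longrightarrow> (\<lambda>z. cnj (f z)) \<in> L2_circle"
  by (simp add: L2_circle_iff borel_measurable_continuous_on[OF continuous_on_cnj[OF continuous_on_id], unfolded id_def])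

lemma L2_circle_Linf_mult:
  assumes "f \<in> L2_circle" "g \<in> Linf_circle"
  shows "(\<lambda>z. g z * f z) \<in> L2_circle"
proof -
  obtain C where C: "AE z in circle_measure. cmod (g z) \<le> C" and [measurable]: "g \<in> borel_measurable borel"
    using assms(2) by (auto simp: Linf_circle_def)
  have [measurable]: "f \<in> borel_measurable borel" using assms(1) by (simp add: L2_circle_iff)
  have "integrable circle_measure (\<lambda>z. (cmod (g z * f z))\<^sup>2)"
  proof (rule Bochner_Integration.integrable_bound)
    show "integrable circle_measure (\<lambda>z. C\<^sup>2 * (cmod (f z))\<^sup>2)"
      using assms by (simp add: L2_circle_iff)
    show "AE z in circle_measure. norm ((cmod (g z * f z))\<^sup>2) \<le> norm (C\<^sup>2 * (cmod (f z))\<^sup>2)"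
      using C by (rule eventually_mono)
        (simp add: norm_mult power_mult_distrib mult_right_mono power_mono abs_mult)
  qed auto
  then show ?thesis by (simp add: L2_circle_iff)
qed

lemma L2_circle_add:
  assumes "f \<in> L2_circle" "h \<in> L2_circle"
  shows "(\<lambda>z. f z + h z) \<in> L2_circle"
proof -
  have [measurable]: "f \<in> borel_measurable borel" "h \<in> borel_measurable borel"
    using assms by (auto simp: L2_circle_iff)
  have "integrable circle_measure (\<lambda>z. (cmod (f z + h z))\<^sup>2)"
  proof (rule Bochner_Integration.integrable_bound)
    show "integrable circle_measure (\<lambda>z. 2 * ((cmod (f z))\<^sup>2 + (cmod (h z))\<^sup>2))"
      using assms by (simp add: L2_circle_iff)
    have "(cmod (f z + h z))\<^sup>2 \<le> 2 * ((cmod (f z))\<^sup>2 + (cmod (h z))\<^sup>2)" for z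
    proof -
      have "(cmod (f z + h z))\<^sup>2 \<le> (cmod (f z) + cmod (h z))\<^sup>2"
        by (intro power_mono norm_triangle_ineq) auto
      also have "\<dots> \<le> 2 * ((cmod (f z))\<^sup>2 + (cmod (h z))\<^sup>2)"
        using sum_squares_bound[of "cmod (f z)" "cmod (h z)"] by (simp add: power2_sum)
      finally show ?thesis .
    qed
    then show "AE z in circle_measure. norm ((cmod (f z + h z))\<^sup>2) \<le> norm (2 * ((cmod (f z))\<^sup>2 + (cmod (h z))\<^sup>2))"
      by simp
  qed auto
  then show ?thesis by (simp add: L2_circle_iff)
qed

lemma L2_circle_diff:
  assumes "f \<in> L2_circle" "h \<in> L2_circle"
  shows "(\<lambda>z. f z - h z) \<in> L2_circle"
  using L2_circle_add[OF assms(1), of "\<lambda>z. - h z"] assms(2) by (simp add: L2_circle_iff)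

section \<open>Fourier coefficients of Hardy functions\<close>

text \<open>By the tail estimate the Taylor polynomials converge to the boundary function in mean
  square, so their integrals against the bounded \<open>v\<close> converge to that of
  \<open>f\<close>. If these integrals are eventually constant, the constant is the limit.\<close>

lemma hardy_circle_pairing:
  assumes f: "f \<in> L2_circle" and F: "F \<in> hardy_disc"
    and lim: "AE z in circle_measure. ((\<lambda>r. F (complex_of_real r * z)) \<longlongrightarrow> f z) (at_left 1)"
    and v: "continuous_on UNIV v" "\<And>z. cmod z = 1 \<Longrightarrow> cmod (v z) \<le> 1"
    and c: "\<And>N. N \<ge> N0 \<Longrightarrow>
      (LINT z|circle_measure. (\<Sum>n<N. (deriv ^^ n) F 0 / fact n * z ^ n) * v z) = c"
  shows "(LINT z|circle_measure. f z * v z) = c"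
proof -
  define a where "a = (\<lambda>n. (deriv ^^ n) F 0 / fact n)"
  define S where "S = (\<lambda>N z. \<Sum>n<N. a n * z ^ n)"
  define e where "e = (\<lambda>N. \<Sum>n. (cmod (a (n + N)))\<^sup>2)"
  have summ: "summable (\<lambda>n. (cmod (a n))\<^sup>2)"
    using F by (simp add: hardy_disc_def a_def)
  have e0: "e N \<ge> 0" for N
    unfolding e_def by (intro suminf_nonneg summable_ignore_initial_segment[OF summ]) auto
  have S: "S N \<in> L2_circle" for N
    unfolding S_def by (intro L2_circle_continuous continuous_intros)
  have vL: "v \<in> L2_circle" by (rule L2_circle_continuous[OF v(1)])
  have [measurable]: "f \<in> borel_measurable borel" "S N \<in> borel_measurable borel" "v \<in> borel_measurable borel" for N
    using f S vL by (auto simp: L2_circle_iff)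
  have bound: "cmod ((LINT z|circle_measure. f z * v z) - c) \<le> sqrt (e N)" if "N \<ge> N0" for N
  proof -
    let ?I = "LINT z|circle_measure. (f z - S N z) * v z"
    have "?I = (LINT z|circle_measure. f z * v z) - (LINT z|circle_measure. S N z * v z)"
      using integrable_L2_mult[OF f vL] integrable_L2_mult[OF S vL] by (simp add: left_diff_distrib)
    then have I: "?I = (LINT z|circle_measure. f z * v z) - c"
      using c[OF that] by (simp add: S_def a_def)
    have "ennreal (cmod ?I) \<le> (\<integral>\<^sup>+z. cmod ((f z - S N z) * v z) \<partial>circle_measure)"
      by (intro integral_norm_bound_ennreal integrable_L2_mult L2_circle_diff f S vL)
    also have "\<dots> \<le> (\<integral>\<^sup>+z. ennreal (cmod (f z - S N z)) * 1 \<partial>circle_measure)"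
      by (intro nn_integral_mono_AE eventually_mono[OF AE_circle_norm])
        (auto simp: norm_mult v(2) intro!: ennreal_leI mult_left_le)
    finally have "(ennreal (cmod ?I))\<^sup>2 \<le> (\<integral>\<^sup>+z. ennreal (cmod (f z - S N z)) * 1 \<partial>circle_measure)\<^sup>2"
      by (intro power_mono) auto
    \<comment> \<open>Cauchy-Schwarz against the constant 1, which has norm 1 in a probability
      space.\<close>
    also have "\<dots> \<le> (\<integral>\<^sup>+z. (ennreal (cmod (f z - S N z)))\<^sup>2 \<partial>circle_measure) * (\<integral>\<^sup>+z. 1\<^sup>2 \<partial>circle_measure)"
      by (intro Cauchy_Schwarz_nn_integral) auto
    also have "\<dots> = (\<integral>\<^sup>+z. (cmod (f z - S N z))\<^sup>2 \<partial>circle_measure)"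
      using emeasure_circle_space by (simp add: ennreal_power)
    also have "\<dots> \<le> ennreal (e N)"
      using hardy_circle_tail[OF F lim, of N] by (simp add: S_def a_def e_def)
    finally have "(cmod ?I)\<^sup>2 \<le> e N"
      using e0[of N] by (simp add: ennreal_power)
    then show ?thesis by (simp add: I real_le_rsqrt)
  qed
  have "(\<lambda>N. sqrt (e N)) \<longlonglongrightarrow> sqrt 0"
    unfolding e_def by (intro tendsto_real_sqrt suminf_exist_split2[OF summ])
  then have "cmod ((LINT z|circle_measure. f z * v z) - c) \<le> 0"
    using bound by (intro tendsto_lowerbound[of "\<lambda>N. sqrt (e N)" 0 sequentially])
      (auto simp: eventually_sequentially)
  then show ?thesis by simp
qed

lemma circle_integral_polynomial_mult:
  "(LINT z|circle_measure. (\<Sum>n<N. b n * z ^ n) * (z ^ k * cnj z ^ m)) =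
    (\<Sum>n<N. if n + k = m then b n else 0)"
proof -
  have "(LINT z|circle_measure. (\<Sum>n<N. b n * z ^ n) * (z ^ k * cnj z ^ m)) =
      (LINT z|circle_measure. (\<Sum>n<N. b n * (z ^ (n + k) * cnj z ^ m)))"
    unfolding sum_distrib_right
    by (intro Bochner_Integration.integral_cong sum.cong refl) (simp add: power_add mult_ac)
  also have "\<dots> = (\<Sum>n<N. LINT z|circle_measure. b n * (z ^ (n + k) * cnj z ^ m))"
    by (intro Bochner_Integration.integral_sum integrable_circle_continuous continuous_intros)
  also have "\<dots> = (\<Sum>n<N. if n + k = m then b n else 0)"
    by (simp add: circle_moment if_distrib[of "\<lambda>x. _ * x"] cong: if_cong)
  finally show ?thesis .
qed

text \<open>Every Taylor polynomial with more than \<open>m\<close> terms already gives this value,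
  whence the threshold \<open>Suc m\<close>.\<close>

lemma hardy_circle_coeff:
  assumes f: "f \<in> L2_circle" and F: "F \<in> hardy_disc"
    and lim: "AE z in circle_measure. ((\<lambda>r. F (complex_of_real r * z)) \<longlongrightarrow> f z) (at_left 1)"
  shows "(LINT z|circle_measure. f z * cnj z ^ m) = (deriv ^^ m) F 0 / fact m"
proof (rule hardy_circle_pairing[OF f F lim])
  show "(LINT z|circle_measure. (\<Sum>n<N. (deriv ^^ n) F 0 / fact n * z ^ n) * cnj z ^ m) =
      (deriv ^^ m) F 0 / fact m" if "N \<ge> Suc m" for N
    using circle_integral_polynomial_mult[of "\<lambda>n. (deriv ^^ n) F 0 / fact n" N 0 m] that by simp
qed (auto intro!: continuous_intros simp: norm_power)

text \<open>A polynomial times \<open>z ^ m\<close> with \<open>m > 0\<close> has only positive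
  powers of \<open>z\<close>, all of which integrate to 0.\<close>

lemma hardy_circle_neg_coeff:
  assumes f: "f \<in> hardy_circle" and "m > 0"
  shows "(LINT z|circle_measure. f z * z ^ m) = 0"
proof -
  obtain F where F: "f \<in> L2_circle" "F \<in> hardy_disc"
    "AE z in circle_measure. ((\<lambda>r. F (complex_of_real r * z)) \<longlongrightarrow> f z) (at_left 1)"
    using f by (auto simp: hardy_circle_def)
  show ?thesis
  proof (rule hardy_circle_pairing[OF F])
    show "(LINT z|circle_measure. (\<Sum>n<N. (deriv ^^ n) F 0 / fact n * z ^ n) * z ^ m) = 0" for N
      using circle_integral_polynomial_mult[of "\<lambda>n. (deriv ^^ n) F 0 / fact n" N m 0] \<open>m > 0\<close> by simp
  qed (auto intro!: continuous_intros simp: norm_power)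
qed

section \<open>Polynomials in the Hardy space, and the model spaces of monomials\<close>

lemma higher_deriv_polynomial:
  "(deriv ^^ k) (\<lambda>z::complex. \<Sum>n<N. b n * z ^ n) 0 / fact k = (if k < N then b k else 0)"
proof -
  have exp: "(\<lambda>z::complex. \<Sum>n<N. b n * z ^ n) has_fps_expansion (\<Sum>n<N. fps_const (b n) * fps_X ^ n)"
    by (intro fps_expansion_intros)
  have "fps_nth (\<Sum>n<N. fps_const (b n) * fps_X ^ n) k = (if k < N then b k else 0)"
    by (simp add: fps_sum_nth fps_X_power_nth if_distrib cong: if_cong)
  then show ?thesis
    unfolding fps_nth_fps_expansion[OF exp] .
qed

lemma polynomial_hardy_disc: "(\<lambda>z. \<Sum>n<N. b n * z ^ n) \<in> hardy_disc"
proof -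
  have "summable (\<lambda>k. (cmod (if k < N then b k else 0))\<^sup>2)"
    by (rule summable_finite[of "{..<N}"]) auto
  then show ?thesis
    unfolding hardy_disc_def mem_Collect_eq higher_deriv_polynomial by (auto intro!: holomorphic_intros)
qed

lemma hardy_circleI_polynomial:
  assumes "f \<in> borel_measurable borel" "AE z in circle_measure. f z = (\<Sum>n<N. b n * z ^ n)"
  shows "f \<in> hardy_circle"
proof -
  let ?p = "\<lambda>z. \<Sum>n<N. b n * z ^ n"
  have cont: "continuous_on UNIV ?p" by (intro continuous_intros)
  obtain B where "AE z in circle_measure. cmod (?p z) \<le> B"
    using AE_bounded_continuous[OF cont] by auto
  with assms(2) have "AE z in circle_measure. cmod (f z) \<le> B"
    by eventually_elim simp
  then have "f \<in> L2_circle"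
    using assms(1) by (intro L2_circle_AE_bounded)
  moreover have "AE z in circle_measure. ((\<lambda>r. ?p (complex_of_real r * z)) \<longlongrightarrow> f z) (at_left 1)"
    using assms(2)
  proof (rule eventually_mono)
    fix z assume z: "f z = ?p z"
    have "((\<lambda>r. ?p (complex_of_real r * z)) \<longlongrightarrow> ?p (complex_of_real 1 * z)) (at_left 1)"
      by (intro tendsto_intros)
    then show "((\<lambda>r. ?p (complex_of_real r * z)) \<longlongrightarrow> f z) (at_left 1)"
      unfolding z by (simp only: of_real_1 mult_1)
  qed
  ultimately show ?thesis
    unfolding hardy_circle_def by (intro CollectI conjI bexI[of _ ?p] polynomial_hardy_disc)
qed

lemma monomial_hardy_circle: "(\<lambda>z. z ^ m) \<in> hardy_circle"
  by (rule hardy_circleI_polynomial[where N = "Suc m" and b = "\<lambda>n. if n = m then 1 else 0"]) 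
    (auto simp: if_distrib[of "\<lambda>x. x * _"] cong: if_cong)

lemma inner_function_monomial: "inner_function (\<lambda>z. z ^ m)"
  unfolding inner_function_def
  using monomial_hardy_circle AE_circle_norm by (auto simp: norm_power elim!: eventually_mono)

text \<open>Orthogonality to \<open>z ^ m * z ^ k\<close> for all \<open>k\<close> kills the Taylor
  coefficients from index \<open>m\<close> on. Conversely, on the circle
  \<open>z ^ n * cnj (z ^ m * h z)\<close> is the conjugate of \<open>h z * z ^ (m - n)\<close>,
  which integrates to 0 for \<open>n < m\<close> because Hardy functions have no negative Fourier
  coefficients.\<close>

lemma model_space_monomial:
  "f \<in> model_space (\<lambda>z. z ^ m) \<longleftrightarrow>
     f \<in> borel_measurable borel \<and> (\<exists>b. AE z in circle_measure. f z = (\<Sum>n<m. b n * z ^ n))"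
proof
  assume "f \<in> model_space (\<lambda>z. z ^ m)"
  then have orth: "\<And>h. h \<in> hardy_circle \<Longrightarrow> L2_inner f (\<lambda>z. z ^ m * h z) = 0" and f: "f \<in> hardy_circle"
    by (auto simp: model_space_def L2_orth_def)
  obtain F where F: "f \<in> L2_circle" "F \<in> hardy_disc"
    "AE z in circle_measure. ((\<lambda>r. F (complex_of_real r * z)) \<longlongrightarrow> f z) (at_left 1)"
    using f by (auto simp: hardy_circle_def)
  define a where "a = (\<lambda>n. (deriv ^^ n) F 0 / fact n)"
  have "a (m + k) = 0" for k
    using hardy_circle_coeff[OF F, of "m + k"] orth[OF monomial_hardy_circle[of k]]
    by (simp add: a_def L2_inner_def power_add)
  then have a0: "a n = 0" if "n \<ge> m" for n
    using that le_Suc_ex by blast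
  have F_poly: "F w = (\<Sum>n<m. a n * w ^ n)" if "cmod w < 1" for w
  proof -
    have "(\<lambda>n. a n * w ^ n) sums F w"
      using holomorphic_power_series[of F 0 1 w] F(2) that by (simp add: hardy_disc_def a_def)
    moreover have "(\<lambda>n. a n * w ^ n) sums (\<Sum>n<m. a n * w ^ n)"
      by (intro sums_finite) (auto simp: a0)
    ultimately show ?thesis by (rule sums_unique2)
  qed
  have "AE z in circle_measure. f z = (\<Sum>n<m. a n * z ^ n)"
    using F(3) AE_circle_norm
  proof eventually_elim
    case (elim z)
    have "((\<lambda>r. \<Sum>n<m. a n * (complex_of_real r * z) ^ n) \<longlongrightarrow> (\<Sum>n<m. a n * (complex_of_real 1 * z) ^ n)) (at_left 1)"
      by (intro tendsto_intros)
    moreover have "\<forall>\<^sub>F r in at_left 1. F (complex_of_real r * z) = (\<Sum>n<m. a n * (complex_of_real r * z) ^ n)"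
      using eventually_at_left_real[of 0 1]
      by (auto elim!: eventually_mono intro!: F_poly simp: norm_mult elim)
    ultimately have "((\<lambda>r. F (complex_of_real r * z)) \<longlongrightarrow> (\<Sum>n<m. a n * z ^ n)) (at_left 1)"
      by (subst tendsto_cong) auto
    with elim(1) show ?case
      by (intro tendsto_unique[of "at_left (1::real)"]) auto
  qed
  with F(1) show "f \<in> borel_measurable borel \<and> (\<exists>b. AE z in circle_measure. f z = (\<Sum>n<m. b n * z ^ n))"
    by (auto simp: L2_circle_iff)
next
  assume "f \<in> borel_measurable borel \<and> (\<exists>b. AE z in circle_measure. f z = (\<Sum>n<m. b n * z ^ n))"
  then obtain b where [measurable]: "f \<in> borel_measurable borel"
    and ae: "AE z in circle_measure. f z = (\<Sum>n<m. b n * z ^ n)" by blast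
  have f: "f \<in> hardy_circle"
    by (rule hardy_circleI_polynomial) (use ae in auto)
  have "L2_inner f (\<lambda>z. z ^ m * h z) = 0" if h: "h \<in> hardy_circle" for h
  proof -
    have hL: "h \<in> L2_circle" using h by (simp add: hardy_circle_def)
    then have [measurable]: "h \<in> borel_measurable borel" by (simp add: L2_circle_iff)
    have cnj_meas [measurable]: "cnj \<in> borel_measurable borel"
      by (intro borel_measurable_continuous_onI continuous_intros)
    have "L2_inner f (\<lambda>z. z ^ m * h z) =
        (LINT z|circle_measure. (\<Sum>n<m. b n * cnj (h z * z ^ (m - n))))"
      unfolding L2_inner_def
    proof (rule integral_cong_AE)
      show "AE z in circle_measure. f z * cnj (z ^ m * h z) = (\<Sum>n<m. b n * cnj (h z * z ^ (m - n)))"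
        using ae AE_circle_norm
      proof eventually_elim
        case (elim z)
        have "z ^ n * cnj (z ^ m) = cnj (z ^ (m - n))" if "n < m" for n
        proof -
          have "z ^ n * cnj z ^ n = 1"
            using elim by (simp add: power_mult_distrib[symmetric] complex_norm_square[symmetric])
          moreover have "cnj z ^ m = cnj z ^ n * cnj z ^ (m - n)"
            using that by (simp add: power_add[symmetric])
          ultimately show ?thesis by (simp add: mult.assoc[symmetric])
        qed
        then have "b n * z ^ n * cnj (z ^ m * h z) = b n * cnj (h z * z ^ (m - n))" if "n < m" for n
          using that by (simp add: mult_ac)
        then show ?case
          unfolding elim sum_distrib_right by (intro sum.cong refl) simp
      qed
    qed auto
    also have "\<dots> = (\<Sum>n<m. b n * cnj (LINT z|circle_measure. h z * z ^ (m - n)))"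
    proof -
      have "integrable circle_measure (\<lambda>z. b n * cnj (h z * z ^ (m - n)))" for n
        by (intro integrable_mult_right integrable_cnj integrable_L2_mult hL L2_circle_continuous continuous_intros)
      then show ?thesis
        by (subst Bochner_Integration.integral_sum) (auto simp del: complex_cnj_mult complex_cnj_power)
    qed
    also have "\<dots> = 0"
      using hardy_circle_neg_coeff[OF h] by simp
    finally show ?thesis .
  qed
  then show "f \<in> model_space (\<lambda>z. z ^ m)"
    using f by (auto simp: model_space_def L2_orth_def hardy_circle_def)
qed

section \<open>Truncated Toeplitz operators for powers of the variable\<close>

lemma Linf_circle_continuous:
  assumes "continuous_on UNIV f"
  shows "f \<in> Linf_circle"
  using AE_bounded_continuous[OF assms] borel_measurable_continuous_onI[OF assms]
  by (simp add: Linf_circle_def measurable_cong_sets[OF sets_circle_measure refl])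

lemma model_space_L2: "f \<in> model_space \<theta> \<Longrightarrow> f \<in> L2_circle"
  by (simp add: model_space_def L2_orth_def)

lemma L2_inner_AE_polynomial:
  assumes w: "w \<in> L2_circle" and k: "k \<in> L2_circle" "AE z in circle_measure. k z = (\<Sum>n<m. b n * z ^ n)"
  shows "L2_inner w k = (\<Sum>n<m. cnj (b n) * (LINT z|circle_measure. w z * cnj z ^ n))"
proof -
  have [measurable]: "w \<in> borel_measurable borel" "k \<in> borel_measurable borel"
    "cnj \<in> borel_measurable borel"
    using w k by (auto simp: L2_circle_iff intro!: borel_measurable_continuous_onI continuous_intros)
  have int: "integrable circle_measure (\<lambda>z. cnj (b n) * (w z * cnj z ^ n))" for n
    by (intro integrable_mult_right integrable_L2_mult w L2_circle_continuous continuous_intros)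
  have "L2_inner w k = (LINT z|circle_measure. (\<Sum>n<m. cnj (b n) * (w z * cnj z ^ n)))"
    unfolding L2_inner_def
  proof (rule integral_cong_AE)
    show "AE z in circle_measure. w z * cnj (k z) = (\<Sum>n<m. cnj (b n) * (w z * cnj z ^ n))"
      using k(2) by (rule eventually_mono) (simp add: sum_distrib_left mult_ac)
  qed auto
  also have "\<dots> = (\<Sum>n<m. cnj (b n) * (LINT z|circle_measure. w z * cnj z ^ n))"
    using int by (subst Bochner_Integration.integral_sum) auto
  finally show ?thesis .
qed

text \<open>The projection disappears when tested against an element of the model space. As
  \<open>L2_proj\<close> is a choice, a projection must first be exhibited: the polynomial
  \<open>p\<close> with the Fourier coefficients of \<open>g f\<close> at 0 to \<open>m - 1\<close>.
  Afterwards only the defining property of the chosen element is used.\<close>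

lemma trunc_toeplitz_monomial:
  assumes f: "f \<in> model_space (\<lambda>z. z ^ m)" and g: "g \<in> Linf_circle"
  shows "L2_inner (trunc_toeplitz (\<lambda>z. z ^ m) g f) f = L2_inner (\<lambda>z. g z * f z) f"
proof -
  let ?K = "model_space (\<lambda>z. z ^ m)"
  define w where "w = (\<lambda>z. g z * f z)"
  have w: "w \<in> L2_circle"
    unfolding w_def by (intro L2_circle_Linf_mult model_space_L2[OF f] g)
  define c where "c = (\<lambda>n. LINT z|circle_measure. w z * cnj z ^ n)"
  define p where "p = (\<lambda>z. \<Sum>n<m. c n * z ^ n)"
  have cont: "continuous_on UNIV p" unfolding p_def by (intro continuous_intros)
  have p: "p \<in> ?K"
    unfolding model_space_monomial using borel_measurable_continuous_onI[OF cont]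
    by (auto simp: p_def)
  have "L2_inner (\<lambda>z. w z - p z) k = 0" if k: "k \<in> ?K" for k
  proof -
    obtain b where b: "AE z in circle_measure. k z = (\<Sum>n<m. b n * z ^ n)"
      using k by (auto simp: model_space_monomial)
    have "(LINT z|circle_measure. (w z - p z) * cnj z ^ n) = 0" if "n < m" for n
    proof -
      have "(\<lambda>z. cnj z ^ n) \<in> L2_circle"
        by (intro L2_circle_continuous continuous_intros)
      then have "(LINT z|circle_measure. (w z - p z) * cnj z ^ n) =
          c n - (LINT z|circle_measure. p z * cnj z ^ n)"
        using integrable_L2_mult[OF w] integrable_L2_mult[OF model_space_L2[OF p]]
        by (simp add: left_diff_distrib c_def)
      also have "(LINT z|circle_measure. p z * cnj z ^ n) = c n"
        using circle_integral_polynomial_mult[of c m 0 n] that by (simp add: p_def)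
      finally show ?thesis by simp
    qed
    then show ?thesis
      using L2_inner_AE_polynomial[OF L2_circle_diff[OF w model_space_L2[OF p]] model_space_L2[OF k] b]
      by simp
  qed
  with p have "\<exists>p. p \<in> ?K \<and> (\<forall>k\<in>?K. L2_inner (\<lambda>z. w z - p z) k = 0)" by blast
  from someI_ex[OF this] have q: "trunc_toeplitz (\<lambda>z. z ^ m) g f \<in> ?K"
    "\<And>k. k \<in> ?K \<Longrightarrow> L2_inner (\<lambda>z. w z - trunc_toeplitz (\<lambda>z. z ^ m) g f z) k = 0"
    unfolding trunc_toeplitz_def L2_proj_def w_def by blast+
  let ?q = "trunc_toeplitz (\<lambda>z. z ^ m) g f"
  have "L2_inner (\<lambda>z. w z - ?q z) f = L2_inner w f - L2_inner ?q f"
    unfolding L2_inner_def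
    using integrable_L2_mult[OF w L2_circle_cnj[OF model_space_L2[OF f]]]
      integrable_L2_mult[OF model_space_L2[OF q(1)] L2_circle_cnj[OF model_space_L2[OF f]]]
    by (simp add: left_diff_distrib)
  with q(2)[OF f] show ?thesis by (simp add: w_def)
qed

text \<open>On the circle the symbol is a Laurent polynomial, \<open>\<tau> k\<close> being the
  coefficient of the power \<open>k - d\<close>. The condition \<open>k + n = j + d\<close>
  expresses \<open>k - d = j - n\<close> without truncated subtraction.\<close>

lemma L2_inner_laurent_polynomial:
  assumes f: "f \<in> L2_circle" "AE z in circle_measure. f z = (\<Sum>n<m. b n * z ^ n)"
  shows "L2_inner (\<lambda>z. (\<Sum>k<M. \<tau> k * z ^ k) * cnj z ^ d * f z) f =
    (\<Sum>j<m. \<Sum>n<m. \<Sum>k<M. if k + n = j + d then \<tau> k * b n * cnj (b j) else 0)"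
proof -
  let ?g = "\<lambda>z. (\<Sum>k<M. \<tau> k * z ^ k) * cnj z ^ d"
  have g: "continuous_on UNIV ?g" by (intro continuous_intros)
  then have gL: "?g \<in> Linf_circle"
    by (rule Linf_circle_continuous)
  have [measurable]: "f \<in> borel_measurable borel" "?g \<in> borel_measurable borel" "cnj \<in> borel_measurable borel"
    using f borel_measurable_continuous_onI[OF g]
    by (auto simp: L2_circle_iff intro!: borel_measurable_continuous_onI continuous_intros)
  have coeff: "(LINT z|circle_measure. ?g z * f z * cnj z ^ j) =
      (\<Sum>n<m. \<Sum>k<M. if k + n = j + d then \<tau> k * b n else 0)" for j
  proof -
    have "(LINT z|circle_measure. ?g z * f z * cnj z ^ j) =
        (LINT z|circle_measure. (\<Sum>n<m. b n * ((\<Sum>k<M. \<tau> k * z ^ k) * (z ^ n * cnj z ^ (j + d)))))"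
    proof (rule integral_cong_AE)
      show "AE z in circle_measure. ?g z * f z * cnj z ^ j =
          (\<Sum>n<m. b n * ((\<Sum>k<M. \<tau> k * z ^ k) * (z ^ n * cnj z ^ (j + d))))"
        using f(2)
      proof (rule eventually_mono)
        fix z assume z: "f z = (\<Sum>n<m. b n * z ^ n)"
        define P where "P = (\<Sum>k<M. \<tau> k * z ^ k)"
        show "?g z * f z * cnj z ^ j = (\<Sum>n<m. b n * ((\<Sum>k<M. \<tau> k * z ^ k) * (z ^ n * cnj z ^ (j + d))))"
          unfolding z P_def[symmetric] by (simp add: sum_distrib_left power_add mult_ac)
      qed
    qed auto
    also have "\<dots> = (\<Sum>n<m. b n * (LINT z|circle_measure. (\<Sum>k<M. \<tau> k * z ^ k) * (z ^ n * cnj z ^ (j + d))))"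
    proof -
      have "integrable circle_measure (\<lambda>z. b n * ((\<Sum>k<M. \<tau> k * z ^ k) * (z ^ n * cnj z ^ (j + d))))" for n
        by (intro integrable_circle_continuous continuous_intros)
      then show ?thesis
        by (subst Bochner_Integration.integral_sum) auto
    qed
    also have "\<dots> = (\<Sum>n<m. \<Sum>k<M. if k + n = j + d then \<tau> k * b n else 0)"
      unfolding circle_integral_polynomial_mult sum_distrib_left
      by (intro sum.cong refl) simp
    finally show ?thesis .
  qed
  show ?thesis
    unfolding L2_inner_AE_polynomial[OF L2_circle_Linf_mult[OF f(1) gL] f] coeff
    unfolding sum_distrib_left by (intro sum.cong refl) simp
qed

text \<open>In the orthonormal basis \<open>1\<close>, \<open>z\<close>, \<open>z ^ 2\<close> of the
  model space the operator has the matrix \<open>T\<close>; passing to coefficient vectors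
  identifies both the quadratic forms and the norms.\<close>

lemma toeplitz_numerical_range:
  fixes T :: "complex ^ 3 ^ 3"
  assumes T: "T$1$1 = T$2$2" "T$2$2 = T$3$3" "T$1$2 = T$2$3" "T$2$1 = T$3$2"
  shows "\<exists>g\<in>Linf_circle. matrix_numerical_range T = tto_numerical_range (\<lambda>z. z ^ 3) g"
proof -
  \<comment> \<open>\<open>\<tau> k\<close> is the entry of \<open>T\<close> on the diagonal \<open>i - j = k - 2\<close>, the coefficient of \<open>z\<^sup>k\<^sup>-\<^sup>2\<close> in the symbol.\<close>
  define \<tau> :: "nat \<Rightarrow> complex" where
    "\<tau> = (\<lambda>k. if k = 0 then T$1$3 else if k = 1 then T$1$2 else if k = 2 then T$1$1 else if k = 3 then T$2$1 else T$3$1)"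
  define g where "g = (\<lambda>z. (\<Sum>k<5. \<tau> k * z ^ k) * cnj z ^ 2)"
  have "continuous_on UNIV g" unfolding g_def by (intro continuous_intros)
  then have g: "g \<in> Linf_circle"
    by (rule Linf_circle_continuous)
  define x :: "(nat \<Rightarrow> complex) \<Rightarrow> complex ^ 3" where
    "x = (\<lambda>b. \<chi> i. if i = 1 then b 0 else if i = 2 then b 1 else b 2)"
  have ne: "(1::3) \<noteq> 2" "(1::3) \<noteq> 3" "(2::3) \<noteq> 3" by auto
  have xs: "x b $ 1 = b 0" "x b $ 2 = b 1" "x b $ 3 = b 2" for b
    using ne by (auto simp: x_def)
  have form: "L2_inner (trunc_toeplitz (\<lambda>z. z ^ 3) g f) f = cvec_inner (T *v x b) (x b)"
    and norm: "L2_inner f f = cvec_inner (x b) (x b)"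
    if f: "f \<in> model_space (\<lambda>z. z ^ 3)" and b: "AE z in circle_measure. f z = (\<Sum>n<3. b n * z ^ n)" for f b
  proof -
    note fL = model_space_L2[OF f]
    show "L2_inner (trunc_toeplitz (\<lambda>z. z ^ 3) g f) f = cvec_inner (T *v x b) (x b)"
      unfolding trunc_toeplitz_monomial[OF f g] unfolding g_def L2_inner_laurent_polynomial[OF fL b]
      by (simp add: cvec_inner_def matrix_vector_mult_def sum_3 xs \<tau>_def T eval_nat_numeral algebra_simps)
    \<comment> \<open>The constant symbol 1 turns the formula for Laurent polynomials into
      Parseval's identity.\<close>
    show "L2_inner f f = cvec_inner (x b) (x b)"
      using L2_inner_laurent_polynomial[OF fL b, where M=1 and \<tau>="\<lambda>_. 1" and d=0]
      by (simp add: cvec_inner_def sum_3 xs eval_nat_numeral)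
  qed
  have "tto_numerical_range (\<lambda>z. z ^ 3) g = matrix_numerical_range T"
  proof (intro equalityI subsetI)
    fix \<zeta> assume "\<zeta> \<in> tto_numerical_range (\<lambda>z. z ^ 3) g"
    then obtain f where f: "f \<in> model_space (\<lambda>z. z ^ 3)" "L2_inner f f = 1"
      "\<zeta> = L2_inner (trunc_toeplitz (\<lambda>z. z ^ 3) g f) f"
      by (auto simp: tto_numerical_range_def numerical_range_def)
    obtain b where "AE z in circle_measure. f z = (\<Sum>n<3. b n * z ^ n)"
      using f(1) by (auto simp: model_space_monomial)
    from form[OF f(1) this] norm[OF f(1) this] f show "\<zeta> \<in> matrix_numerical_range T"
      by (auto simp: matrix_numerical_range_def numerical_range_def)
  next
    fix \<zeta> assume "\<zeta> \<in> matrix_numerical_range T"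
    then obtain y where y: "cvec_inner y y = 1" "\<zeta> = cvec_inner (T *v y) y"
      by (auto simp: matrix_numerical_range_def numerical_range_def)
    define b where "b = (\<lambda>n::nat. if n = 0 then y$1 else if n = 1 then y$2 else y$3)"
    have xb: "x b = y" by (simp add: vec_eq_iff forall_3 xs b_def)
    define f where "f = (\<lambda>z. \<Sum>n<3. b n * z ^ n)"
    have "continuous_on UNIV f" unfolding f_def by (intro continuous_intros)
    then have f: "f \<in> model_space (\<lambda>z. z ^ 3)"
      unfolding model_space_monomial using borel_measurable_continuous_onI by (auto simp: f_def)
    have b: "AE z in circle_measure. f z = (\<Sum>n<3. b n * z ^ n)" by (simp add: f_def)
    from form[OF f b] norm[OF f b] y f show "\<zeta> \<in> tto_numerical_range (\<lambda>z. z ^ 3) g"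
      unfolding xb tto_numerical_range_def numerical_range_def by force
  qed
  with g show ?thesis by blast
qed

section \<open>Numerical ranges of matrices\<close>

lemma cvec_inner_add_left: "cvec_inner (x + y) z = cvec_inner x z + cvec_inner y z"
  and cvec_inner_add_right: "cvec_inner z (x + y) = cvec_inner z x + cvec_inner z y"
  and cvec_inner_scale_left: "cvec_inner (c *s x) z = c * cvec_inner x z"
  and cvec_inner_scale_right: "cvec_inner z (c *s x) = cnj c * cvec_inner z x"
  and cvec_inner_commute: "cnj (cvec_inner x y) = cvec_inner y x"
  by (simp_all add: cvec_inner_def sum.distrib sum_distrib_left algebra_simps)

lemma Re_cvec_inner: "Re (cvec_inner x y) = x \<bullet> y"
  by (simp add: cvec_inner_def inner_vec_def inner_complex_def)

lemma cvec_inner_self: "cvec_inner x x = of_real (x \<bullet> x)"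
proof -
  have "Im (cvec_inner x x) = 0"
    by (simp add: cvec_inner_def mult.commute)
  then show ?thesis
    by (simp add: complex_eq_iff Re_cvec_inner)
qed

lemma matrix_numerical_range_sphere:
  fixes A :: "complex ^ 'n ^ 'n"
  shows "matrix_numerical_range A = (\<lambda>x. cvec_inner (A *v x) x) ` sphere 0 1"
proof -
  have "cvec_inner x x = 1 \<longleftrightarrow> norm x = 1" for x :: "complex ^ 'n"
    by (simp add: cvec_inner_self norm_eq_1)
  then show ?thesis
    by (auto simp: matrix_numerical_range_def numerical_range_def)
qed

lemma continuous_on_cvec_form: "continuous_on S (\<lambda>x. cvec_inner (A *v x) x)"
  unfolding cvec_inner_def matrix_vector_mult_def by (auto intro!: continuous_intros)

lemma compact_matrix_numerical_range: "compact (matrix_numerical_range A)"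
  unfolding matrix_numerical_range_sphere
  by (intro compact_continuous_image continuous_on_cvec_form) auto

text \<open>The imaginary part in question equals \<open>Im (c * (a - cnj b))\<close>, so it
  suffices to rotate \<open>a - cnj b\<close> onto the real axis.\<close>

lemma exists_unimodular_real:
  fixes a b :: complex
  shows "\<exists>c. cmod c = 1 \<and> Im (c * a + cnj c * b) = 0"
proof -
  define d where "d = a - cnj b"
  define c where "c = (if d = 0 then 1 else cnj d / of_real (cmod d))"
  have "cmod c = 1" by (simp add: c_def norm_divide)
  moreover have "Im (c * d) = 0"
    by (simp add: c_def mult.commute)
  then have "Im (c * a + cnj c * b) = 0"
    by (simp add: d_def algebra_simps)
  ultimately show ?thesis by blast
qed

lemma convex_matrix_numerical_range:
  fixes A :: "complex ^ 'n ^ 'n"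
  shows "convex (matrix_numerical_range A)"
proof (unfold convex_alt, intro ballI allI impI, elim conjE)
  fix a b :: complex and t :: real
  assume ab: "a \<in> matrix_numerical_range A" "b \<in> matrix_numerical_range A" and t: "0 \<le> t" "t \<le> 1"
  show "(1 - t) *\<^sub>R a + t *\<^sub>R b \<in> matrix_numerical_range A"
  proof (cases "a = b")
    case True
    then show ?thesis using ab by (simp add: algebra_simps)
  next
    case False
    obtain x y where x: "norm x = 1" "a = cvec_inner (A *v x) x" and y: "norm y = 1" "b = cvec_inner (A *v y) y"
      using ab by (auto simp: matrix_numerical_range_sphere)
    \<comment> \<open>Toeplitz--Hausdorff: the affine normalization of the form, with values \<open>0\<close> at \<open>x\<close> and \<open>1\<close> at \<open>y\<close>.\<close>
    define \<psi> where "\<psi> = (\<lambda>v w. (cvec_inner (A *v v) w - a * cvec_inner v w) / (b - a))"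
    have lin: "\<psi> (u + v) w = \<psi> u w + \<psi> v w" "\<psi> w (u + v) = \<psi> w u + \<psi> w v"
      "\<psi> (c *s u) w = c * \<psi> u w" "\<psi> w (c *s u) = cnj c * \<psi> w u" for u v w c
      using False
      by (simp_all add: \<psi>_def matrix_vector_right_distrib vector_scalar_commute cvec_inner_add_left cvec_inner_add_right
          cvec_inner_scale_left cvec_inner_scale_right add_divide_distrib diff_divide_distrib algebra_simps)
    have \<psi>xx: "\<psi> x x = 0" and \<psi>yy: "\<psi> y y = 1"
      using x y False by (simp_all add: \<psi>_def cvec_inner_self norm_eq_1)
    \<comment> \<open>The phase \<open>c\<close> makes the cross terms real, so the normalized form
      is real along the whole path \<open>v\<close> from \<open>c *s x\<close> to \<open>y\<close>;
      the intermediate value theorem then applies to its quotient by the squared norm.\<close>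
    obtain c where c: "cmod c = 1" "Im (c * \<psi> x y + cnj c * \<psi> y x) = 0"
      using exists_unimodular_real by blast
    define r where "r = Re (c * \<psi> x y + cnj c * \<psi> y x)"
    have r: "c * \<psi> x y + cnj c * \<psi> y x = of_real r"
      using c(2) by (simp add: r_def complex_eq_iff)
    define v where "v = (\<lambda>s::real. (of_real (1 - s) * c) *s x + of_real s *s y)"
    have gen: "\<psi> (p *s x + q *s y) (p *s x + q *s y) = q * cnj q + (p * cnj q * \<psi> x y + q * cnj p * \<psi> y x)" for p q
      unfolding lin \<psi>xx \<psi>yy by (simp add: algebra_simps)
    have \<psi>v: "\<psi> (v s) (v s) = of_real (s\<^sup>2 + s * (1 - s) * r)" for s
    proof -
      have "\<psi> (v s) (v s) = of_real s * of_real s + of_real s * of_real (1 - s) * (c * \<psi> x y + cnj c * \<psi> y x)"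
        unfolding v_def gen complex_cnj_mult complex_cnj_complex_of_real by (simp only: distrib_left mult_ac)
      then show ?thesis
        unfolding r by (simp only: of_real_add of_real_mult power2_eq_square)
    qed
    \<comment> \<open>If \<open>v s\<close> vanished, \<open>s *s y\<close> would be a multiple of
      \<open>x\<close>, where the form is 0. Since \<open>\<psi> y y = 1\<close>, this forces
      \<open>s = 0\<close>, and then \<open>c *s x = 0\<close>, which is impossible.\<close>
    have v0: "v s \<noteq> 0" for s
    proof
      assume 0: "v s = 0"
      have eq: "of_real s *s y = (- (of_real (1 - s) * c)) *s x"
        using 0 unfolding v_def vec_eq_iff by (auto simp only: vector_add_component vector_smult_component
            zero_index mult_minus_left eq_neg_iff_add_eq_0 add.commute)
      have "\<psi> (of_real s *s y) (of_real s *s y) = 0"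
        unfolding eq lin \<psi>xx by simp
      then have "s = 0" unfolding lin \<psi>yy by simp
      then have "c *s x = 0" using 0 by (simp add: v_def)
      then show False using c(1) x(1) by auto
    qed
    define f where "f = (\<lambda>s. (s\<^sup>2 + s * (1 - s) * r) / (v s \<bullet> v s))"
    have cont: "continuous_on {0..1} f"
      unfolding f_def
    proof (intro continuous_intros ballI)
      show "continuous_on {0..1} v"
        unfolding v_def vector_scalar_mult_def by (auto intro!: continuous_intros)
      then show "continuous_on {0..1} v" .
    qed (use v0 in auto)
    have "f 0 = 0" "f 1 = 1" using y(1) by (simp_all add: f_def v_def norm_eq_1)
    then obtain s where s: "f s = t"
      using IVT'[of f 0 t 1] t cont by auto
    define n where "n = norm (v s)"
    have n: "n > 0" "v s \<bullet> v s = n ^ 2" using v0 by (simp_all add: n_def power2_norm_eq_inner)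
    define z where "z = of_real (1 / n) *s v s"
    have "z = (1 / n) *\<^sub>R v s" 
      by (simp only: z_def vec_eq_iff vector_scaleR_component vector_smult_component) (simp add: scaleR_conv_of_real)
    then have nz: "norm z = 1" using n by (simp add: n_def)
    have "\<psi> z z = of_real t"
      unfolding z_def lin \<psi>v s[symmetric] f_def n(2) by (simp add: power2_eq_square)
    moreover have "cvec_inner z z = 1"
      using nz by (simp add: cvec_inner_self norm_eq_1)
    ultimately have "(cvec_inner (A *v z) z - a) / (b - a) = of_real t"
      by (simp add: \<psi>_def)
    then have eq: "cvec_inner (A *v z) z - a = of_real t * (b - a)"
      using False by (simp only: nonzero_divide_eq_eq right_minus_eq not_sym simp_thms)
    have "cvec_inner (A *v z) z = a + (cvec_inner (A *v z) z - a)" by simp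
    also have "\<dots> = (1 - t) *\<^sub>R a + t *\<^sub>R b"
      unfolding eq by (simp add: scaleR_conv_of_real algebra_simps)
    finally show ?thesis
      unfolding matrix_numerical_range_sphere using nz by (intro image_eqI[of _ _ z]) simp_all
  qed
qed

section \<open>Extremal eigenvectors of Hermitian matrices\<close>

lemma cvec_inner_hermitian:
  fixes N :: "complex ^ 'n ^ 'n"
  assumes "\<And>i j. N $ i $ j = cnj (N $ j $ i)"
  shows "cvec_inner (N *v x) y = cvec_inner x (N *v y)"
proof -
  have "cvec_inner (N *v x) y = (\<Sum>i\<in>UNIV. \<Sum>j\<in>UNIV. N $ i $ j * x $ j * cnj (y $ i))"
    by (simp add: cvec_inner_def matrix_vector_mult_def sum_distrib_right)
  also have "\<dots> = (\<Sum>j\<in>UNIV. \<Sum>i\<in>UNIV. N $ i $ j * x $ j * cnj (y $ i))"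
    by (rule sum.swap)
  also have "\<dots> = cvec_inner x (N *v y)"
    unfolding cvec_inner_def matrix_vector_mult_def
    by (simp add: sum_distrib_left)
      (intro sum.cong refl, subst assms, simp add: mult_ac)
  finally show ?thesis .
qed

lemma matrix_vector_mult_scaleR_complex:
  fixes N :: "complex ^ 'n ^ 'm"
  shows "N *v (t *\<^sub>R x) = t *\<^sub>R (N *v x)"
  by (simp add: vec_eq_iff matrix_vector_mult_def scaleR_sum_right)

text \<open>The first-order condition at a maximum, without derivatives: with \<open>D\<close>
  positive and larger than \<open>C\<close>, the test point \<open>p / D\<close> gives
  \<open>2 * p^2 \<le> p^2\<close>.\<close>

lemma linear_dominated_by_quadratic:
  fixes p C :: real
  assumes "\<And>t. 2 * t * p \<le> t\<^sup>2 * C"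
  shows "p = 0"
proof (rule ccontr)
  assume "p \<noteq> 0"
  define D where "D = \<bar>C\<bar> + 1"
  have D: "D > 0" "C < D" by (auto simp: D_def)
  have "2 * (p / D) * p \<le> (p / D)\<^sup>2 * C" by (rule assms)
  also have "\<dots> \<le> (p / D)\<^sup>2 * D"
    using D by (intro mult_left_mono) auto
  finally have "2 * p\<^sup>2 \<le> p\<^sup>2" using D by (simp add: field_simps power2_eq_square)
  then show False using \<open>p \<noteq> 0\<close> by simp
qed

text \<open>Rayleigh's principle: a maximizer of the quadratic form on the unit sphere of an
  invariant subspace is an eigenvector. Giving \<open>S\<close> as an orthogonal complement makes it
  a closed subspace; \<open>W = {}\<close> yields the whole space, and a singleton yields the next
  eigenvector.\<close>

lemma hermitian_maximal_eigenvector: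
  fixes N :: "complex ^ 'n ^ 'n" and W :: "(complex ^ 'n) set"
  defines "S \<equiv> {x. \<forall>w\<in>W. cvec_inner x w = 0}"
  assumes herm: "\<And>i j. N $ i $ j = cnj (N $ j $ i)"
    and inv: "\<And>x. x \<in> S \<Longrightarrow> N *v x \<in> S"
    and x0: "x0 \<in> S" "x0 \<noteq> 0"
  obtains x M where "norm x = 1" "x \<in> S" "N *v x = of_real M *s x"
    "\<And>y. y \<in> S \<Longrightarrow> (N *v y) \<bullet> y \<le> M * (y \<bullet> y)"
proof -
  define Q where "Q = (\<lambda>y. (N *v y) \<bullet> y)"
  have S_add: "x + y \<in> S" if "x \<in> S" "y \<in> S" for x y
    using that by (auto simp: S_def cvec_inner_add_left)
  have S_scaleR: "t *\<^sub>R x \<in> S" if "x \<in> S" for x t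
  proof -
    have "of_real t *s x \<in> S"
      using that by (auto simp: S_def cvec_inner_scale_left)
    then show ?thesis
      by (simp add: vector_scalar_mult_def scaleR_vec_def scaleR_conv_of_real)
  qed
  note scaleR = matrix_vector_mult_scaleR_complex
  have closed: "closed S"
  proof -
    have "closed {x. cvec_inner x w = 0}" for w
      unfolding cvec_inner_def by (intro closed_Collect_eq continuous_intros)
    moreover have "S = (\<Inter>w\<in>W. {x. cvec_inner x w = 0})" by (auto simp: S_def)
    ultimately show ?thesis by auto
  qed
  have "compact (sphere 0 1 \<inter> S)" using closed by (intro compact_Int_closed) auto
  moreover have "(1 / norm x0) *\<^sub>R x0 \<in> sphere 0 1 \<inter> S"
    using x0 S_scaleR by simp
  then have "sphere 0 1 \<inter> S \<noteq> {}" by blast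
  moreover have "continuous_on (sphere 0 1 \<inter> S) Q"
    unfolding Q_def matrix_vector_mult_def by (auto intro!: continuous_intros)
  ultimately obtain x where x: "x \<in> sphere 0 1 \<inter> S" and max: "\<And>y. y \<in> sphere 0 1 \<inter> S \<Longrightarrow> Q y \<le> Q x"
    using continuous_attains_sup by metis
  define M where "M = Q x"
  have le: "Q y \<le> M * (y \<bullet> y)" if y: "y \<in> S" for y
  proof (cases "y = 0")
    case False
    define t where "t = 1 / norm y"
    have "t *\<^sub>R y \<in> sphere 0 1 \<inter> S"
      using y S_scaleR False by (simp add: t_def)
    from max[OF this] have "t\<^sup>2 * Q y \<le> M"
      by (simp add: Q_def M_def scaleR power2_eq_square)
    then show ?thesis
      using False by (simp add: t_def field_simps power2_norm_eq_inner)
  qed (simp add: Q_def)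
  \<comment> \<open>The residual lies in \<open>S\<close>, hence is an admissible direction. Along
    it the difference between the form and \<open>M\<close> times the squared norm has derivative
    \<open>2 * (u \<bullet> u)\<close> at \<open>x\<close>, which must vanish at a maximum.\<close>
  define u where "u = N *v x - M *\<^sub>R x"
  have u: "u \<in> S"
    using S_add[OF inv S_scaleR, of x x "- M"] x by (simp add: u_def)
  have "u \<bullet> u = 0"
  proof (rule linear_dominated_by_quadratic)
    fix t
    have "x + t *\<^sub>R u \<in> S" using x u S_add S_scaleR by blast
    from le[OF this] have "Q (x + t *\<^sub>R u) \<le> M * ((x + t *\<^sub>R u) \<bullet> (x + t *\<^sub>R u))" .
    moreover have "(N *v u) \<bullet> x = u \<bullet> (N *v x)"
      using cvec_inner_hermitian[OF herm, of u x] by (metis Re_cvec_inner)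
    moreover have "x \<bullet> x = 1" using x by (simp add: norm_eq_1[symmetric])
    ultimately have "2 * t * ((N *v x) \<bullet> u - M * (x \<bullet> u)) \<le> t\<^sup>2 * (M * (u \<bullet> u) - Q u)"
      by (simp add: Q_def M_def matrix_vector_right_distrib scaleR inner_add_left inner_add_right
          inner_commute power2_eq_square algebra_simps)
    moreover have "(N *v x) \<bullet> u - M * (x \<bullet> u) = u \<bullet> u"
      by (simp add: u_def inner_diff_left)
    ultimately show "2 * t * (u \<bullet> u) \<le> t\<^sup>2 * (M * (u \<bullet> u) - Q u)" by simp
  qed
  then have "N *v x = of_real M *s x"
    by (simp add: u_def vector_scalar_mult_def scaleR_vec_def scaleR_conv_of_real)
  with x le show ?thesis by (intro that[of x M]) (auto simp: Q_def)
qed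

lemma hermitian_top_eigenvector:
  fixes N :: "complex ^ 'n ^ 'n"
  assumes herm: "\<And>i j. N $ i $ j = cnj (N $ j $ i)"
  obtains x M where "norm x = 1" "N *v x = of_real M *s x" "\<And>y. (N *v y) \<bullet> y \<le> M * (y \<bullet> y)"
proof (rule hermitian_maximal_eigenvector[of N "{}" "\<chi> i. 1", OF herm])
  show "(\<chi> i. 1) \<noteq> (0 :: complex ^ 'n)" by (simp add: vec_eq_iff)
  note witness = that
  show thesis if "norm x = 1" "N *v x = of_real M *s x"
    "\<And>y. y \<in> {x. \<forall>w\<in>{}. cvec_inner x w = 0} \<Longrightarrow> (N *v y) \<bullet> y \<le> M * (y \<bullet> y)" for x M
    using that(3) by (intro witness[OF that(1,2)]) simp
qed simp_all

lemma det_eq_0_iff_kernel: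
  fixes N :: "complex ^ 'n ^ 'n"
  shows "det N = 0 \<longleftrightarrow> (\<exists>x. x \<noteq> 0 \<and> N *v x = 0)"
  using invertible_det_nz[of N] matrix_left_invertible_ker[of N] invertible_left_inverse[of N] by blast

lemma det_eq_0_iff_eigenvalue:
  fixes N :: "complex ^ 'n ^ 'n"
  shows "det (mat c - N) = 0 \<longleftrightarrow> (\<exists>x. x \<noteq> 0 \<and> N *v x = c *s x)"
proof -
  have mat: "mat c *v x = c *s x" for x :: "complex ^ 'n"
  proof -
    have "(if i = j then c else 0) * x $ j = (if i = j then c * x $ i else 0)" for i j
      by simp
    then show ?thesis
      by (simp add: vec_eq_iff matrix_vector_mult_def mat_def)
  qed
  have "(mat c - N) *v x = 0 \<longleftrightarrow> N *v x = c *s x" for x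
    unfolding matrix_vector_mult_diff_rdistrib mat right_minus_eq by (rule eq_commute)
  then show ?thesis by (simp add: det_eq_0_iff_kernel)
qed

section \<open>Numerical ranges determined by pencils, and changes of orthonormal basis\<close>

text \<open>Twice the Hermitian part of \<open>w A\<close>. Its largest eigenvalue is twice the
  maximum of \<open>Re (w * z)\<close> over the numerical range, so the pencil encodes the
  supporting lines.\<close>

definition real_pencil :: "complex ^ 'n ^ 'n \<Rightarrow> complex \<Rightarrow> complex ^ 'n ^ 'n" where
  "real_pencil A w = (\<chi> i j. w * A $ i $ j + cnj (w * A $ j $ i))"

lemma real_pencil_hermitian: "real_pencil A w $ i $ j = cnj (real_pencil A w $ j $ i)"
  by (simp add: real_pencil_def)

lemma cvec_inner_real_pencil:
  "cvec_inner (real_pencil A w *v x) y = w * cvec_inner (A *v x) y + cnj (w * cvec_inner (A *v y) x)"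
proof -
  have "cvec_inner (real_pencil A w *v x) y =
      (\<Sum>i\<in>UNIV. \<Sum>j\<in>UNIV. w * (A $ i $ j * x $ j * cnj (y $ i))) +
      (\<Sum>i\<in>UNIV. \<Sum>j\<in>UNIV. cnj (w * (A $ j $ i * y $ i * cnj (x $ j))))"
    by (simp add: cvec_inner_def matrix_vector_mult_def real_pencil_def sum_distrib_right
        sum_distrib_left sum.distrib[symmetric] algebra_simps)
  also have "(\<Sum>i\<in>UNIV. \<Sum>j\<in>UNIV. cnj (w * (A $ j $ i * y $ i * cnj (x $ j)))) =
      (\<Sum>j\<in>UNIV. \<Sum>i\<in>UNIV. cnj (w * (A $ j $ i * y $ i * cnj (x $ j))))"
    by (rule sum.swap)
  also have "(\<Sum>i\<in>UNIV. \<Sum>j\<in>UNIV. w * (A $ i $ j * x $ j * cnj (y $ i))) + \<dots> =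
      w * cvec_inner (A *v x) y + cnj (w * cvec_inner (A *v y) x)"
    by (simp add: cvec_inner_def matrix_vector_mult_def sum_distrib_right sum_distrib_left)
  finally show ?thesis .
qed

lemma real_pencil_inner: "(real_pencil A w *v x) \<bullet> x = 2 * Re (w * cvec_inner (A *v x) x)"
  unfolding Re_cvec_inner[symmetric] cvec_inner_real_pencil by simp

text \<open>A point \<open>z\<close> outside the compact convex range of \<open>B\<close> is
  strictly separated from it. In that direction the largest eigenvalue \<open>M\<close> of the
  pencil of \<open>A\<close> is at least \<open>2 * Re (w * z)\<close>; equal determinants make
  \<open>M\<close> an eigenvalue for \<open>B\<close> too, so \<open>M / 2\<close> is the value of
  \<open>Re (w * _)\<close> at a point of the range of \<open>B\<close>, against the
  separation.\<close>

lemma numerical_range_subset_of_pencil: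
  fixes A B :: "complex ^ 'n ^ 'n"
  assumes det: "\<And>w \<mu>. det (mat (complex_of_real \<mu>) - real_pencil A w) = det (mat (complex_of_real \<mu>) - real_pencil B w)"
  shows "matrix_numerical_range A \<subseteq> matrix_numerical_range B"
proof
  fix z assume z: "z \<in> matrix_numerical_range A"
  show "z \<in> matrix_numerical_range B"
  proof (rule ccontr)
    assume "z \<notin> matrix_numerical_range B"
    from separating_hyperplane_closed_point[OF convex_matrix_numerical_range
        compact_imp_closed[OF compact_matrix_numerical_range] this]
    obtain a b where sep: "a \<bullet> z < b" "\<And>x. x \<in> matrix_numerical_range B \<Longrightarrow> a \<bullet> x > b"
      by blast
    \<comment> \<open>The sign reverses the separation: \<open>Re (w * z)\<close> exceeds
      \<open>Re (w * x)\<close> for all \<open>x\<close> in the range of \<open>B\<close>.\<close>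
    define w where "w = - cnj a"
    have w: "Re (w * x) = - (a \<bullet> x)" for x
      by (simp add: w_def inner_complex_def)
    obtain x M where x: "norm x = 1" "real_pencil A w *v x = of_real M *s x"
      and max: "\<And>y. (real_pencil A w *v y) \<bullet> y \<le> M * (y \<bullet> y)"
      using hermitian_top_eigenvector[of "real_pencil A w", OF real_pencil_hermitian] by blast
    have "det (mat (complex_of_real M) - real_pencil A w) = 0"
      unfolding det_eq_0_iff_eigenvalue using x by (intro exI[of _ x]) auto
    then obtain y where y: "y \<noteq> 0" "real_pencil B w *v y = of_real M *s y"
      unfolding det det_eq_0_iff_eigenvalue by blast
    define y' where "y' = (1 / norm y) *\<^sub>R y"
    have "t *\<^sub>R (c *s y) = c *s (t *\<^sub>R y)" for t :: real and c
      by (simp add: vec_eq_iff)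
    then have y': "norm y' = 1" "real_pencil B w *v y' = of_real M *s y'"
      unfolding y'_def matrix_vector_mult_scaleR_complex using y by simp_all
    have "2 * Re (w * cvec_inner (B *v y') y') = Re (cvec_inner (of_real M *s y') y')"
      by (simp only: Re_cvec_inner y'(2) real_pencil_inner[symmetric])
    also have "\<dots> = M"
      unfolding cvec_inner_scale_left cvec_inner_self using y'(1) by (simp add: norm_eq_1)
    finally have "2 * Re (w * cvec_inner (B *v y') y') = M" .
    moreover have "cvec_inner (B *v y') y' \<in> matrix_numerical_range B"
      using y'(1) by (auto simp: matrix_numerical_range_sphere)
    moreover obtain v where "norm v = 1" "z = cvec_inner (A *v v) v"
      using z by (auto simp: matrix_numerical_range_sphere)
    then have "2 * Re (w * z) \<le> M"
      using max[of v] by (simp add: real_pencil_inner norm_eq_1)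
    ultimately show False
      using sep w by (smt (verit))
  qed
qed

lemma numerical_range_eq_of_pencil:
  fixes A B :: "complex ^ 'n ^ 'n"
  assumes "\<And>w \<mu>. det (mat (complex_of_real \<mu>) - real_pencil A w) = det (mat (complex_of_real \<mu>) - real_pencil B w)"
  shows "matrix_numerical_range A = matrix_numerical_range B"
  using assms by (intro equalityI numerical_range_subset_of_pencil) simp_all

text \<open>For an orthonormal family \<open>X\<close> this is the matrix of \<open>A\<close> in the
  basis \<open>X\<close>: column \<open>j\<close> holds the coordinates of the image of
  \<open>X j\<close>.\<close>

definition compression :: "complex ^ 'n ^ 'n \<Rightarrow> ('n \<Rightarrow> complex ^ 'n) \<Rightarrow> complex ^ 'n ^ 'n" where
  "compression A X = (\<chi> i j. cvec_inner (A *v X j) (X i))"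

text \<open>The matrix \<open>P\<close> with columns \<open>X j\<close> is unitary and carries the
  form of the compression to that of \<open>A\<close>. Surjectivity holds because a left inverse of
  a square matrix is also a right inverse.\<close>

lemma numerical_range_compression:
  fixes A :: "complex ^ 'n ^ 'n"
  assumes orth: "\<And>i j. cvec_inner (X i) (X j) = (if i = j then 1 else 0)"
  shows "matrix_numerical_range (compression A X) = matrix_numerical_range A"
proof -
  define P :: "complex ^ 'n ^ 'n" where "P = (\<chi> i j. X j $ i)"
  define P' :: "complex ^ 'n ^ 'n" where "P' = (\<chi> i j. cnj (X i $ j))"
  have "P' ** P = mat 1"
    using orth by (simp add: vec_eq_iff P_def P'_def matrix_matrix_mult_def mat_def cvec_inner_def mult.commute)
  then have PP': "P ** P' = mat 1" by (simp add: matrix_left_right_inverse)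
  have P: "P *v c = (\<Sum>j\<in>UNIV. c $ j *s X j)" for c :: "complex ^ 'n"
    by (simp add: vec_eq_iff P_def matrix_vector_mult_def mult.commute)
  have inner: "cvec_inner (\<Sum>j\<in>UNIV. c $ j *s Y j) (\<Sum>i\<in>UNIV. d $ i *s X i) =
      (\<Sum>i\<in>UNIV. (\<Sum>j\<in>UNIV. cvec_inner (Y j) (X i) * c $ j) * cnj (d $ i))" for Y :: "'n \<Rightarrow> complex ^ 'n" and c d
  proof -
    have l: "cvec_inner (\<Sum>j\<in>J. c $ j *s Y j) z = (\<Sum>j\<in>J. c $ j * cvec_inner (Y j) z)" if "finite J" for J z
      using that by induction (simp_all add: cvec_inner_add_left cvec_inner_scale_left, simp add: cvec_inner_def)
    have r: "cvec_inner z (\<Sum>j\<in>J. d $ j *s X j) = (\<Sum>j\<in>J. cnj (d $ j) * cvec_inner z (X j))" if "finite J" for J z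
      using that by induction (simp_all add: cvec_inner_add_right cvec_inner_scale_right, simp add: cvec_inner_def)
    show ?thesis by (simp add: l r mult.commute)
  qed
  have form: "cvec_inner (A *v (P *v c)) (P *v c) = cvec_inner (compression A X *v c) c" for c :: "complex ^ 'n"
  proof -
    have "A *v (P *v c) = (\<Sum>j\<in>UNIV. c $ j *s (A *v X j))"
      unfolding P by (simp add: vec.linear_sum[OF matrix_vector_mul_linear_gen] vector_scalar_commute)
    then show ?thesis
      by (simp add: P inner compression_def) (simp add: cvec_inner_def matrix_vector_mult_def)
  qed
  have norm: "cvec_inner (P *v c) (P *v c) = cvec_inner c c" for c :: "complex ^ 'n"
    unfolding P inner orth by (simp add: cvec_inner_def if_distrib[of "\<lambda>x. x * _"] cong: if_cong)
  have onto: "P *v (P' *v y) = y" for y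
    by (simp add: matrix_vector_mul_assoc PP')
  show ?thesis
    unfolding matrix_numerical_range_def numerical_range_def
  proof (intro equalityI subsetI; clarify)
    fix c :: "complex ^ 'n" assume "cvec_inner c c = 1"
    then show "\<exists>y. cvec_inner (compression A X *v c) c = cvec_inner (A *v y) y \<and> y \<in> UNIV \<and> cvec_inner y y = 1"
      using form norm by (intro exI[of _ "P *v c"]) simp
  next
    fix y :: "complex ^ 'n" assume "cvec_inner y y = 1"
    then show "\<exists>c. cvec_inner (A *v y) y = cvec_inner (compression A X *v c) c \<and> c \<in> UNIV \<and> cvec_inner c c = 1"
      using form[of "P' *v y"] norm[of "P' *v y"] by (intro exI[of _ "P' *v y"]) (simp add: onto)
  qed
qed

section \<open>Two intermediate value arguments\<close>

lemma IVT_zero: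
  fixes f :: "real \<Rightarrow> real"
  assumes "continuous_on UNIV f" "f s \<le> 0" "f t \<ge> 0"
  shows "\<exists>x. f x = 0"
proof (cases "s \<le> t")
  case True
  then show ?thesis
    using IVT'[of f s 0 t] assms continuous_on_subset[OF assms(1)] by auto
next
  case False
  then show ?thesis
    using IVT2'[of f s 0 t] assms continuous_on_subset[OF assms(1)] by auto
qed

text \<open>The witness is the cross product of \<open>(a1, a2, a3)\<close> with
  \<open>(1, 1, 1)\<close>, which vanishes only if all \<open>a\<close> agree; a nonzero vector with
  coordinate sum 0 has a negative coordinate.\<close>

lemma exists_orthogonal_direction:
  fixes a1 a2 a3 :: real
  shows "\<exists>d1 d2 d3. d1 + d2 + d3 = 0 \<and> a1 * d1 + a2 * d2 + a3 * d3 = 0 \<and> (d1 < 0 \<or> d2 < 0 \<or> d3 < 0)"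
proof (cases "a1 = a2 \<and> a2 = a3")
  case True
  then show ?thesis by (intro exI[of _ "-1"] exI[of _ 1] exI[of _ 0]) auto
next
  case False
  then show ?thesis
    by (intro exI[of _ "a2 - a3"] exI[of _ "a3 - a1"] exI[of _ "a1 - a2"]) (auto simp: algebra_simps)
qed

text \<open>Here \<open>u\<close> stands for the squared moduli of the off-diagonal entries,
  \<open>c\<close> for twice the real part of their product, and \<open>a\<close>, \<open>m\<close>
  for the real and imaginary parts of the diagonal. The three preserved quantities are those through
  which the off-diagonal entries enter the determinant of the pencil.\<close>

lemma real_offdiagonal:
  fixes a1 a2 a3 m1 m2 m3 c u1 u2 u3 :: real
  assumes u: "u1 \<ge> 0" "u2 \<ge> 0" "u3 \<ge> 0" and c: "c\<^sup>2 \<le> 4 * u1 * u2 * u3"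
  shows "\<exists>v1 v2 v3. v1\<^sup>2 + v2\<^sup>2 + v3\<^sup>2 = u1 + u2 + u3 \<and>
    a1 * v1\<^sup>2 + a2 * v2\<^sup>2 + a3 * v3\<^sup>2 = a1 * u1 + a2 * u2 + a3 * u3 \<and>
    2 * (v1 * v2 * v3) - (m1 * v1\<^sup>2 + m2 * v2\<^sup>2 + m3 * v3\<^sup>2) = c - (m1 * u1 + m2 * u2 + m3 * u3)"
proof -
  obtain d1 d2 d3 where d: "d1 + d2 + d3 = 0" "a1 * d1 + a2 * d2 + a3 * d3 = 0" "d1 < 0 \<or> d2 < 0 \<or> d3 < 0"
    using exists_orthogonal_direction by blast
  \<comment> \<open>The smallest coordinate on the line. It is nonnegative at 0 and nonpositive
    somewhere further on, so the line meets the boundary of the octant, where the product of the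
    coordinates vanishes.\<close>
  define h where "h = (\<lambda>s. min (u1 + s * d1) (min (u2 + s * d2) (u3 + s * d3)))"
  have "\<exists>s\<ge>0. h s \<le> 0"
  proof -
    have *: "u + u / (- e) * e = 0" "u / (- e) \<ge> 0" if "e < 0" "u \<ge> 0" for u e :: real
      using that by (auto simp: field_simps)
    from d(3) show ?thesis
    proof (elim disjE)
      assume "d1 < 0"
      from *[OF this u(1)] show ?thesis
        by (intro exI[of _ "u1 / (- d1)"]) (simp add: h_def min_le_iff_disj)
    next
      assume "d2 < 0"
      from *[OF this u(2)] show ?thesis
        by (intro exI[of _ "u2 / (- d2)"]) (simp add: h_def min_le_iff_disj)
    next
      assume "d3 < 0"
      from *[OF this u(3)] show ?thesis
        by (intro exI[of _ "u3 / (- d3)"]) (simp add: h_def min_le_iff_disj)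
    qed
  qed
  then obtain s0 where s0: "s0 \<ge> 0" "h s0 \<le> 0" by blast
  have "continuous_on {0..s0} h" unfolding h_def by (intro continuous_intros)
  then obtain s1 where s1: "0 \<le> s1" "h s1 = 0"
    using IVT2'[of h s0 0 0] s0 u by (auto simp: h_def)
  \<comment> \<open>Along the line \<open>u + s d\<close> the first two constraints persist; the third one becomes solvable where \<open>G\<close> vanishes.\<close>
  define G where "G = (\<lambda>s. 4 * ((u1 + s * d1) * (u2 + s * d2) * (u3 + s * d3)) - (c + s * (m1 * d1 + m2 * d2 + m3 * d3))\<^sup>2)"
  have "u1 + s1 * d1 = 0 \<or> u2 + s1 * d2 = 0 \<or> u3 + s1 * d3 = 0" and
    nonneg1: "u1 + s1 * d1 \<ge> 0" "u2 + s1 * d2 \<ge> 0" "u3 + s1 * d3 \<ge> 0"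
    using s1(2) unfolding h_def by (auto simp: min_def split: if_splits)
  then have "(u1 + s1 * d1) * (u2 + s1 * d2) * (u3 + s1 * d3) = 0" by (simp only: mult_eq_0_iff) blast
  then have "G s1 \<le> 0" unfolding G_def by (simp only: mult_zero_right) simp
  moreover have "G 0 \<ge> 0" using c by (simp add: G_def)
  moreover have "continuous_on {0..s1} G" unfolding G_def by (intro continuous_intros)
  ultimately obtain s where s: "0 \<le> s" "s \<le> s1" "G s = 0"
    using IVT2'[of G s1 0 0] s1(1) by auto
  \<comment> \<open>An affine function that is nonnegative at 0 and at \<open>s1\<close> is
    nonnegative in between, so the square roots below are legitimate.\<close>
  have "u + s * e \<ge> 0" if "u \<ge> 0" "u + s1 * e \<ge> 0" for u e
  proof (cases "e \<ge> 0")
    case False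
    then have "s1 * e \<le> s * e" using s(2) by (simp add: mult_right_mono_neg)
    then show ?thesis using that by linarith
  qed (use that s in simp)
  then have nonneg: "u1 + s * d1 \<ge> 0" "u2 + s * d2 \<ge> 0" "u3 + s * d3 \<ge> 0"
    using u nonneg1 by auto
  define v1 v2 v3 where v: "v1 = sqrt (u1 + s * d1)" "v2 = sqrt (u2 + s * d2)" "v3 = sqrt (u3 + s * d3)"
  have sq: "v1\<^sup>2 = u1 + s * d1" "v2\<^sup>2 = u2 + s * d2" "v3\<^sup>2 = u3 + s * d3"
    using nonneg by (simp_all add: v)
  define L where "L = c + s * (m1 * d1 + m2 * d2 + m3 * d3)"
  have "(2 * (v1 * v2 * v3))\<^sup>2 = L\<^sup>2"
    using s(3) by (simp add: G_def L_def power_mult_distrib sq)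
  then have "2 * (v1 * v2 * v3) = L \<or> 2 * (v1 * v2 * v3) = - L"
    by (simp only: power2_eq_iff)
  \<comment> \<open>\<open>G s = 0\<close> fixes the product only up to sign; replacing
    \<open>v1\<close> by \<open>- v1\<close> corrects the sign and keeps all squares.\<close>
  then have "L = 2 * (v1 * v2 * v3) \<or> L = 2 * ((- v1) * v2 * v3)"
    by (simp only: mult_minus_left mult_minus_right) linarith
  moreover have "v1\<^sup>2 + v2\<^sup>2 + v3\<^sup>2 = u1 + u2 + u3 + s * (d1 + d2 + d3)"
    "a1 * v1\<^sup>2 + a2 * v2\<^sup>2 + a3 * v3\<^sup>2 = a1 * u1 + a2 * u2 + a3 * u3 + s * (a1 * d1 + a2 * d2 + a3 * d3)"
    "L - (m1 * v1\<^sup>2 + m2 * v2\<^sup>2 + m3 * v3\<^sup>2) = c - (m1 * u1 + m2 * u2 + m3 * u3)"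
    unfolding sq by (simp_all add: L_def algebra_simps)
  ultimately show ?thesis
    unfolding d(1,2) mult_zero_right add_0_right
    by (elim disjE) (rule exI[of _ v1] exI[of _ "- v1"], rule exI[of _ v2], rule exI[of _ v3], simp only: power2_minus)+
qed

section \<open>Common zeros of a traceless form and a traceless diagonal form\<close>

text \<open>The form of a real symmetric matrix with diagonal \<open>k1\<close>, \<open>k2\<close>,
  \<open>k3\<close>; each \<open>l\<close> is the off-diagonal entry for the two coordinates other
  than its index.\<close>

definition qform3 :: "real \<Rightarrow> real \<Rightarrow> real \<Rightarrow> real \<Rightarrow> real \<Rightarrow> real \<Rightarrow> real \<Rightarrow> real \<Rightarrow> real \<Rightarrow> real" where
  "qform3 k1 k2 k3 l1 l2 l3 x y z =
    k1 * x\<^sup>2 + k2 * y\<^sup>2 + k3 * z\<^sup>2 + 2 * (l1 * y * z + l2 * x * z + l3 * x * y)"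

lemma qform3_scale: "qform3 k1 k2 k3 l1 l2 l3 (t * x) (t * y) (t * z) = t\<^sup>2 * qform3 k1 k2 k3 l1 l2 l3 x y z"
  by (simp add: qform3_def power_mult_distrib power2_eq_square algebra_simps)

text \<open>For a traceless form the values at the four sign vectors sum to zero; these vectors lie on every
  cone \<open>\<alpha> x\<^sup>2 + \<beta> y\<^sup>2 + \<gamma> z\<^sup>2 = 0\<close> with \<open>\<alpha> + \<beta> + \<gamma> = 0\<close>, and a path on the cone joins a nonpositive
  to a nonnegative value.\<close>

lemma qform3_signs:
  assumes "k1 + k2 + k3 = 0"
  obtains e1 e2 f1 f2 where "{e1, e2, f1, f2} \<subseteq> {-1, 1}"
    "qform3 k1 k2 k3 l1 l2 l3 e1 1 e2 \<le> 0" "qform3 k1 k2 k3 l1 l2 l3 f1 1 f2 \<ge> 0"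
proof -
  let ?q = "\<lambda>x z. qform3 k1 k2 k3 l1 l2 l3 x 1 z"
  have sum: "?q 1 1 + ?q (-1) 1 + ?q 1 (-1) + ?q (-1) (-1) = 0"
    using assms by (simp add: qform3_def)
  then have "?q 1 1 \<le> 0 \<or> ?q (-1) 1 \<le> 0 \<or> ?q 1 (-1) \<le> 0 \<or> ?q (-1) (-1) \<le> 0"
    "?q 1 1 \<ge> 0 \<or> ?q (-1) 1 \<ge> 0 \<or> ?q 1 (-1) \<ge> 0 \<or> ?q (-1) (-1) \<ge> 0"
    by linarith+
  then have "\<exists>e1\<in>{-1, 1}. \<exists>e2\<in>{-1, 1}. ?q e1 e2 \<le> 0" "\<exists>f1\<in>{-1, 1}. \<exists>f2\<in>{-1, 1}. ?q f1 f2 \<ge> 0"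
    by auto
  then show thesis using that by blast
qed

text \<open>The cone is a pair of planes, \<open>z = y\<close> and \<open>z = - y\<close>, sharing
  the first axis, where the form has the value \<open>k1\<close>. Some sign vector has a value of
  the opposite weak sign; in the plane containing it, selected by \<open>g\<close>, an arc joins it
  up to scaling to the first axis.\<close>

lemma cone_zero_degenerate:
  assumes k: "k1 + k2 + k3 = 0"
  shows "\<exists>x y z. (x, y, z) \<noteq> (0, 0, 0) \<and> y\<^sup>2 = z\<^sup>2 \<and> qform3 k1 k2 k3 l1 l2 l3 x y z = 0"
proof -
  let ?q = "qform3 k1 k2 k3 l1 l2 l3"
  obtain e1 e2 f1 f2 where ef: "{e1, e2, f1, f2} \<subseteq> {-1, 1}" "?q e1 1 e2 \<le> 0" "?q f1 1 f2 \<ge> 0"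
    by (rule qform3_signs[OF k])
  have root: "\<exists>t. ?q (cos t) (sin t) (g * sin t) = 0"
    if g: "g \<in> {-1, 1}" and s: "?q (cos s) (sin s) (g * sin s) \<le> 0" "?q (cos s') (sin s') (g * sin s') \<ge> 0" for g s s'
    using s by (intro IVT_zero[of _ s s']) (auto simp: qform3_def intro!: continuous_intros)
  have pt: "\<exists>s. ?q (cos s) (sin s) (g * sin s) = ?q e 1 g / 2" if "e \<in> {-1, 1}" for e g
  proof -
    \<comment> \<open>This scales \<open>(e, 1)\<close> to the unit circle, which halves the value
      of the form.\<close>
    define r where "r = 1 / sqrt 2"
    have r: "r\<^sup>2 = 1 / 2" by (simp add: r_def power_divide)
    have "(r * e)\<^sup>2 + r\<^sup>2 = 1" using that r by (auto simp: power_mult_distrib)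
    then obtain s where "r * e = cos s" "r = sin s"
      using sincos_total_2pi by metis
    then have "?q (cos s) (sin s) (g * sin s) = ?q (r * e) (r * 1) (r * g)"
      by (simp add: mult.commute)
    then show ?thesis unfolding qform3_scale r by auto
  qed
  have k1: "?q (cos 0) (sin 0) (g * sin 0) = k1" for g by (simp add: qform3_def)
  obtain g t where g: "g \<in> {-1, 1}" and t: "?q (cos t) (sin t) (g * sin t) = 0"
  proof (cases "k1 \<ge> 0")
    case True
    obtain s where "?q (cos s) (sin s) (e2 * sin s) = ?q e1 1 e2 / 2" using pt[of e1 e2] ef(1) by auto
    then have 1: "?q (cos s) (sin s) (e2 * sin s) \<le> 0" using ef(2) by linarith
    have 2: "?q (cos 0) (sin 0) (e2 * sin 0) \<ge> 0" unfolding k1 by (rule True)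
    have e2: "e2 \<in> {-1, 1}" using ef(1) by simp
    from root[OF e2 1 2] that[OF e2] show ?thesis by blast
  next
    case False
    obtain s where "?q (cos s) (sin s) (f2 * sin s) = ?q f1 1 f2 / 2" using pt[of f1 f2] ef(1) by auto
    then have 1: "?q (cos s) (sin s) (f2 * sin s) \<ge> 0" using ef(3) by linarith
    have 2: "?q (cos 0) (sin 0) (f2 * sin 0) \<le> 0" unfolding k1 using False by simp
    have f2: "f2 \<in> {-1, 1}" using ef(1) by simp
    from root[OF f2 2 1] that[OF f2] show ?thesis by blast
  qed
  have "cos t \<noteq> 0 \<or> sin t \<noteq> 0" using sin_cos_squared_add[of t] by (auto simp: power2_eq_square)
  then show ?thesis
    using g t by (intro exI[of _ "cos t"] exI[of _ "sin t"] exI[of _ "g * sin t"]) (auto simp: power_mult_distrib)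
qed

text \<open>The section of the cone at height \<open>y = 1 / r\<close> is the ellipse
  \<open>(cos t / p, 1 / r, sin t / q)\<close>. It passes through all sign vectors with middle
  coordinate 1, scaled by \<open>1 / r\<close>, so the form changes sign weakly along it.\<close>

lemma cone_zero_regular:
  fixes \<alpha> \<gamma> :: real
  assumes k: "k1 + k2 + k3 = 0" and pos: "\<alpha> > 0" "\<gamma> > 0"
  shows "\<exists>x y z. (x, y, z) \<noteq> (0, 0, 0) \<and> \<alpha> * x\<^sup>2 + \<gamma> * z\<^sup>2 = (\<alpha> + \<gamma>) * y\<^sup>2 \<and> qform3 k1 k2 k3 l1 l2 l3 x y z = 0"
proof -
  let ?q = "qform3 k1 k2 k3 l1 l2 l3"
  define p q r where pqr: "p = sqrt \<alpha>" "q = sqrt \<gamma>" "r = sqrt (\<alpha> + \<gamma>)"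
  have sq: "p\<^sup>2 = \<alpha>" "q\<^sup>2 = \<gamma>" "r\<^sup>2 = \<alpha> + \<gamma>" and nz: "p > 0" "q > 0" "r > 0"
    using pos by (auto simp: pqr)
  define f where "f = (\<lambda>t. ?q (cos t / p) (1 / r) (sin t / q))"
  have cont: "continuous_on UNIV f"
    unfolding f_def qform3_def using nz by (auto intro!: continuous_intros)
  obtain e1 e2 f1 f2 where ef: "{e1, e2, f1, f2} \<subseteq> {-1, 1}" "?q e1 1 e2 \<le> 0" "?q f1 1 f2 \<ge> 0"
    by (rule qform3_signs[OF k])
  have pt: "\<exists>s. f s = (1 / r)\<^sup>2 * ?q e 1 g" if "e \<in> {-1, 1}" "g \<in> {-1, 1}" for e g
  proof -
    have "(e * p / r)\<^sup>2 + (g * q / r)\<^sup>2 = (p\<^sup>2 + q\<^sup>2) / r\<^sup>2"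
      using that by (auto simp: power_divide power_mult_distrib add_divide_distrib)
    also have "\<dots> = 1" using pos sq by simp
    finally obtain s where s: "e * p / r = cos s" "g * q / r = sin s"
      using sincos_total_2pi by metis
    have "f s = ?q (1 / r * e) (1 / r * 1) (1 / r * g)"
      unfolding f_def s[symmetric] using nz by simp
    then show ?thesis unfolding qform3_scale by blast
  qed
  obtain s where s: "f s = (1 / r)\<^sup>2 * ?q e1 1 e2" using pt[of e1 e2] ef(1) by auto
  obtain s' where s': "f s' = (1 / r)\<^sup>2 * ?q f1 1 f2" using pt[of f1 f2] ef(1) by auto
  obtain t where t: "f t = 0"
    using IVT_zero[OF cont, of s s'] s s' ef by (auto simp: mult_le_0_iff)
  have "\<alpha> * (cos t / p)\<^sup>2 + \<gamma> * (sin t / q)\<^sup>2 = (cos t)\<^sup>2 + (sin t)\<^sup>2"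
    using nz unfolding sq(1,2)[symmetric] by (simp add: power_divide)
  also have "\<dots> = (\<alpha> + \<gamma>) * (1 / r)\<^sup>2"
    using nz unfolding sq(3)[symmetric] by (simp add: power_divide)
  finally show ?thesis
    using t nz unfolding f_def by (intro exI[of _ "cos t / p"] exI[of _ "1 / r"] exI[of _ "sin t / q"]) auto
qed

text \<open>If no coefficient of the cone vanishes, two of the three have the same sign; a
  permutation of the coordinates moves them to the outer positions. Otherwise a vanishing
  coefficient is moved to the first position.\<close>

lemma cone_zero:
  fixes \<alpha> \<beta> \<gamma> :: real
  assumes k: "k1 + k2 + k3 = 0" and sum: "\<alpha> + \<beta> + \<gamma> = 0"
  shows "\<exists>x y z. (x, y, z) \<noteq> (0, 0, 0) \<and> \<alpha> * x\<^sup>2 + \<beta> * y\<^sup>2 + \<gamma> * z\<^sup>2 = 0 \<and> qform3 k1 k2 k3 l1 l2 l3 x y z = 0"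
proof -
  have swap_xy: "qform3 k2 k1 k3 l2 l1 l3 y x z = qform3 k1 k2 k3 l1 l2 l3 x y z"
    and swap_yz: "qform3 k1 k3 k2 l1 l3 l2 x z y = qform3 k1 k2 k3 l1 l2 l3 x y z"
    and swap_xz: "qform3 k3 k2 k1 l3 l2 l1 z y x = qform3 k1 k2 k3 l1 l2 l3 x y z" for k1 k2 k3 l1 l2 l3 x y z
    by (simp_all add: qform3_def algebra_simps)
  have odd: "\<exists>x y z. (x, y, z) \<noteq> (0, 0, 0) \<and> \<alpha> * x\<^sup>2 + \<beta> * y\<^sup>2 + \<gamma> * z\<^sup>2 = 0 \<and> qform3 k1 k2 k3 l1 l2 l3 x y z = 0"
    if k: "k1 + k2 + k3 = 0" and sum: "\<alpha> + \<beta> + \<gamma> = 0" and "\<alpha> * \<gamma> > 0" for k1 k2 k3 l1 l2 l3 \<alpha> \<beta> \<gamma> :: real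
  proof -
    have \<beta>: "\<beta> = - (\<alpha> + \<gamma>)" using sum by simp
    consider "\<alpha> > 0" "\<gamma> > 0" | "- \<alpha> > 0" "- \<gamma> > 0"
      using \<open>\<alpha> * \<gamma> > 0\<close> by (auto simp: zero_less_mult_iff)
    then show ?thesis
    proof cases
      case 1
      from cone_zero_regular[OF k 1, of l1 l2 l3] obtain x y z where
        xyz: "(x, y, z) \<noteq> (0, 0, 0)" "qform3 k1 k2 k3 l1 l2 l3 x y z = 0"
        and eq: "\<alpha> * x\<^sup>2 + \<gamma> * z\<^sup>2 = (\<alpha> + \<gamma>) * y\<^sup>2" by blast
      have "\<alpha> * x\<^sup>2 + \<beta> * y\<^sup>2 + \<gamma> * z\<^sup>2 = 0"
        unfolding \<beta> mult_minus_left eq[symmetric] by simp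
      with xyz show ?thesis by blast
    next
      case 2
      from cone_zero_regular[OF k 2, of l1 l2 l3] obtain x y z where
        xyz: "(x, y, z) \<noteq> (0, 0, 0)" "qform3 k1 k2 k3 l1 l2 l3 x y z = 0"
        and eq: "- \<alpha> * x\<^sup>2 + - \<gamma> * z\<^sup>2 = (- \<alpha> + - \<gamma>) * y\<^sup>2" by blast
      have "\<beta> = - \<alpha> + - \<gamma>" using \<beta> by simp
      then have "\<alpha> * x\<^sup>2 + \<beta> * y\<^sup>2 + \<gamma> * z\<^sup>2 = 0"
        by (simp only: eq[symmetric])
      with xyz show ?thesis by blast
    qed
  qed
  have degenerate: "\<exists>x y z. (x, y, z) \<noteq> (0, 0, 0) \<and> \<alpha> * x\<^sup>2 + \<beta> * y\<^sup>2 + \<gamma> * z\<^sup>2 = 0 \<and> qform3 k1 k2 k3 l1 l2 l3 x y z = 0"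
    if k: "k1 + k2 + k3 = 0" and sum: "\<alpha> + \<beta> + \<gamma> = 0" and "\<alpha> = 0" for k1 k2 k3 l1 l2 l3 \<alpha> \<beta> \<gamma> :: real
  proof -
    have \<beta>: "\<beta> = - \<gamma>" using that by simp
    from cone_zero_degenerate[OF k, of l1 l2 l3] obtain x y z where
      xyz: "(x, y, z) \<noteq> (0, 0, 0)" "qform3 k1 k2 k3 l1 l2 l3 x y z = 0" and eq: "y\<^sup>2 = z\<^sup>2" by blast
    have "\<alpha> * x\<^sup>2 + \<beta> * y\<^sup>2 + \<gamma> * z\<^sup>2 = 0"
      unfolding \<beta> \<open>\<alpha> = 0\<close> eq by simp
    with xyz show ?thesis by blast
  qed
  have "\<alpha> = 0 \<or> \<beta> = 0 \<or> \<gamma> = 0 \<or> \<alpha> * \<gamma> > 0 \<or> \<beta> * \<gamma> > 0 \<or> \<alpha> * \<beta> > 0"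
    unfolding zero_less_mult_iff by linarith
  then consider "\<alpha> = 0" | "\<beta> = 0" | "\<gamma> = 0" | "\<alpha> * \<gamma> > 0" | "\<beta> * \<gamma> > 0" | "\<alpha> * \<beta> > 0"
    by blast
  then show ?thesis
  proof cases
    case 1
    show ?thesis by (rule degenerate[OF k sum 1])
  next
    case 2
    have "k2 + k1 + k3 = 0" "\<beta> + \<alpha> + \<gamma> = 0" using k sum by simp_all
    from degenerate[OF this 2, of l2 l1 l3] obtain y x z where "(y, x, z) \<noteq> (0, 0, 0)"
      "\<beta> * y\<^sup>2 + \<alpha> * x\<^sup>2 + \<gamma> * z\<^sup>2 = 0" "qform3 k2 k1 k3 l2 l1 l3 y x z = 0" by blast
    note xyz = this
    have "(x, y, z) \<noteq> (0, 0, 0)" using xyz(1) by auto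
    moreover have "\<alpha> * x\<^sup>2 + \<beta> * y\<^sup>2 + \<gamma> * z\<^sup>2 = 0" using xyz(2) by linarith
    moreover note trans[OF swap_xy[symmetric] xyz(3)]
    ultimately show ?thesis by (intro exI conjI)
  next
    case 3
    have "k3 + k2 + k1 = 0" "\<gamma> + \<beta> + \<alpha> = 0" using k sum by simp_all
    from degenerate[OF this 3, of l3 l2 l1] obtain z y x where "(z, y, x) \<noteq> (0, 0, 0)"
      "\<gamma> * z\<^sup>2 + \<beta> * y\<^sup>2 + \<alpha> * x\<^sup>2 = 0" "qform3 k3 k2 k1 l3 l2 l1 z y x = 0" by blast
    note xyz = this
    have "(x, y, z) \<noteq> (0, 0, 0)" using xyz(1) by auto
    moreover have "\<alpha> * x\<^sup>2 + \<beta> * y\<^sup>2 + \<gamma> * z\<^sup>2 = 0" using xyz(2) by linarith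
    moreover note trans[OF swap_xz[symmetric] xyz(3)]
    ultimately show ?thesis by (intro exI conjI)
  next
    case 4
    show ?thesis by (rule odd[OF k sum 4])
  next
    case 5
    have "k2 + k1 + k3 = 0" "\<beta> + \<alpha> + \<gamma> = 0" using k sum by simp_all
    from odd[OF this 5, of l2 l1 l3] obtain y x z where "(y, x, z) \<noteq> (0, 0, 0)"
      "\<beta> * y\<^sup>2 + \<alpha> * x\<^sup>2 + \<gamma> * z\<^sup>2 = 0" "qform3 k2 k1 k3 l2 l1 l3 y x z = 0" by blast
    note xyz = this
    have "(x, y, z) \<noteq> (0, 0, 0)" using xyz(1) by auto
    moreover have "\<alpha> * x\<^sup>2 + \<beta> * y\<^sup>2 + \<gamma> * z\<^sup>2 = 0" using xyz(2) by linarith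
    moreover note trans[OF swap_xy[symmetric] xyz(3)]
    ultimately show ?thesis by (intro exI conjI)
  next
    case 6
    have "k1 + k3 + k2 = 0" "\<alpha> + \<gamma> + \<beta> = 0" using k sum by simp_all
    from odd[OF this 6, of l1 l3 l2] obtain x z y where "(x, z, y) \<noteq> (0, 0, 0)"
      "\<alpha> * x\<^sup>2 + \<gamma> * z\<^sup>2 + \<beta> * y\<^sup>2 = 0" "qform3 k1 k3 k2 l1 l3 l2 x z y = 0" by blast
    note xyz = this
    have "(x, y, z) \<noteq> (0, 0, 0)" using xyz(1) by auto
    moreover have "\<alpha> * x\<^sup>2 + \<beta> * y\<^sup>2 + \<gamma> * z\<^sup>2 = 0" using xyz(2) by linarith
    moreover note trans[OF swap_yz[symmetric] xyz(3)]
    ultimately show ?thesis by (intro exI conjI)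
  qed
qed

text \<open>Subtracting the means makes both forms traceless; a common nonzero zero, scaled to norm
  1, then takes the two mean values.\<close>

lemma unit_vector_mean_values:
  fixes a1 a2 a3 k1 k2 k3 l1 l2 l3 :: real
  shows "\<exists>x y z. x\<^sup>2 + y\<^sup>2 + z\<^sup>2 = 1 \<and> a1 * x\<^sup>2 + a2 * y\<^sup>2 + a3 * z\<^sup>2 = (a1 + a2 + a3) / 3 \<and>
    qform3 k1 k2 k3 l1 l2 l3 x y z = (k1 + k2 + k3) / 3"
proof -
  define A K where "A = (a1 + a2 + a3) / 3" and "K = (k1 + k2 + k3) / 3"
  obtain x y z where xyz: "(x, y, z) \<noteq> (0, 0, 0)"
    and 1: "(a1 - A) * x\<^sup>2 + (a2 - A) * y\<^sup>2 + (a3 - A) * z\<^sup>2 = 0"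
    and 2: "qform3 (k1 - K) (k2 - K) (k3 - K) l1 l2 l3 x y z = 0"
    using cone_zero[of "k1 - K" "k2 - K" "k3 - K" "a1 - A" "a2 - A" "a3 - A" l1 l2 l3]
    by (auto simp: A_def K_def field_simps)
  define n where "n = x\<^sup>2 + y\<^sup>2 + z\<^sup>2"
  have "n > 0" using xyz by (auto simp: n_def add_pos_nonneg add_nonneg_pos)
  define t where "t = 1 / sqrt n"
  have t: "t\<^sup>2 * n = 1" using \<open>n > 0\<close> by (simp add: t_def power_divide)
  have "(t * x)\<^sup>2 + (t * y)\<^sup>2 + (t * z)\<^sup>2 = 1"
    using t by (simp add: n_def power_mult_distrib algebra_simps)
  moreover have "a1 * (t * x)\<^sup>2 + a2 * (t * y)\<^sup>2 + a3 * (t * z)\<^sup>2 = t\<^sup>2 * (a1 * x\<^sup>2 + a2 * y\<^sup>2 + a3 * z\<^sup>2)"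
    by (simp add: power_mult_distrib algebra_simps)
  moreover have "a1 * x\<^sup>2 + a2 * y\<^sup>2 + a3 * z\<^sup>2 = A * n"
    using 1 by (simp add: n_def algebra_simps)
  moreover have "qform3 k1 k2 k3 l1 l2 l3 x y z = K * n"
    using 2 by (simp add: n_def qform3_def algebra_simps)
  ultimately show ?thesis
    unfolding A_def[symmetric] K_def[symmetric] using t
    by (intro exI[of _ "t * x"] exI[of _ "t * y"] exI[of _ "t * z"]) (simp add: qform3_scale)
qed

section \<open>From arbitrary to symmetric to Toeplitz matrices\<close>

lemma UNIV_3_neq: "(1::3) \<noteq> 2" "(1::3) \<noteq> 3" "(2::3) \<noteq> 3" "(2::3) \<noteq> 1" "(3::3) \<noteq> 1" "(3::3) \<noteq> 2"
  by auto

text \<open>The two conditions form the first two rows of a linear system whose third row is 0, so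
  its determinant vanishes.\<close>

lemma exists_unit_orthogonal:
  fixes p q :: "complex ^ 3"
  shows "\<exists>x. norm x = 1 \<and> cvec_inner x p = 0 \<and> cvec_inner x q = 0"
proof -
  define N :: "complex ^ 3 ^ 3" where
    "N = (\<chi> i j. if i = 1 then cnj (p $ j) else if i = 2 then cnj (q $ j) else 0)"
  have "det N = 0"
    by (simp add: det_3 N_def UNIV_3_neq)
  then obtain x where x: "x \<noteq> 0" "N *v x = 0"
    using det_eq_0_iff_kernel by blast
  have "(N *v x) $ 1 = cvec_inner x p" "(N *v x) $ 2 = cvec_inner x q"
    by (simp_all add: matrix_vector_mult_def N_def cvec_inner_def UNIV_3_neq mult.commute)
  then have "cvec_inner x p = 0" "cvec_inner x q = 0"
    using x(2) by simp_all
  moreover have "(1 / norm x) *\<^sub>R x = of_real (1 / norm x) *s x"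
    by (simp only: vec_eq_iff vector_scaleR_component vector_smult_component) (simp add: scaleR_conv_of_real)
  moreover have "norm ((1 / norm x) *\<^sub>R x) = 1" using x(1) by simp
  ultimately show ?thesis
    by (intro exI[of _ "(1 / norm x) *\<^sub>R x"]) (simp only: cvec_inner_scale_left mult_zero_right simp_thms)
qed

text \<open>Two eigenvectors suffice: any unit vector orthogonal to both may be the third, since
  Hermitian symmetry moves \<open>N\<close> onto the eigenvectors in the remaining off-diagonal
  entries.\<close>

lemma hermitian_diagonalization:
  fixes N :: "complex ^ 3 ^ 3"
  assumes herm: "\<And>i j. N $ i $ j = cnj (N $ j $ i)"
  obtains X :: "3 \<Rightarrow> complex ^ 3" where
    "\<And>i j. cvec_inner (X i) (X j) = (if i = j then 1 else 0)"
    "\<And>i j. i \<noteq> j \<Longrightarrow> cvec_inner (N *v X j) (X i) = 0"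
proof -
  have unit: "cvec_inner x x = 1" if "norm x = 1" for x :: "complex ^ 3"
    using that by (simp add: cvec_inner_self norm_eq_1)
  obtain x1 M1 where x1: "norm x1 = 1" "N *v x1 = of_real M1 *s x1"
    using hermitian_top_eigenvector[OF herm] by blast
  obtain x0 where x0: "norm x0 = 1" "cvec_inner x0 x1 = 0"
    using exists_unit_orthogonal by blast
  let ?S = "{x. \<forall>w\<in>{x1}. cvec_inner x w = 0}"
  obtain x2 M2 where x2: "norm x2 = 1" "cvec_inner x2 x1 = 0" "N *v x2 = of_real M2 *s x2"
  proof (rule hermitian_maximal_eigenvector[of N "{x1}" x0, OF herm])
    show "N *v x \<in> ?S" if "x \<in> ?S" for x
      using that by (simp add: cvec_inner_hermitian[OF herm] x1(2) cvec_inner_scale_right)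
    show "x0 \<in> ?S" "x0 \<noteq> 0" using x0 by auto
  qed auto
  obtain x3 where x3: "norm x3 = 1" "cvec_inner x3 x1 = 0" "cvec_inner x3 x2 = 0"
    using exists_unit_orthogonal by blast
  define X :: "3 \<Rightarrow> complex ^ 3" where "X = (\<lambda>i. if i = 1 then x1 else if i = 2 then x2 else x3)"
  have X: "X 1 = x1" "X 2 = x2" "X 3 = x3" by (simp_all add: X_def UNIV_3_neq)
  have sym: "cvec_inner x1 x2 = 0" "cvec_inner x1 x3 = 0" "cvec_inner x2 x3 = 0"
    using x2(2) x3(2,3) cvec_inner_commute by (metis complex_cnj_zero)+
  have "\<forall>i j. cvec_inner (X i) (X j) = (if i = j then 1 else 0)"
    unfolding forall_3 X using x2(2) x3(2,3) sym unit[OF x1(1)] unit[OF x2(1)] unit[OF x3(1)]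
    by (simp add: UNIV_3_neq)
  moreover have "\<forall>i j. i \<noteq> j \<longrightarrow> cvec_inner (N *v X j) (X i) = 0"
    unfolding forall_3 X using x2(2) x3(2,3) sym
    by (simp add: x1(2) x2(3) cvec_inner_scale_left cvec_inner_hermitian[OF herm, of x3] cvec_inner_scale_right)
  ultimately show thesis by (intro that[of X]) blast+
qed

section \<open>Symmetric matrices with the same numerical range\<close>

text \<open>The off-diagonal part of \<open>C\<close> is \<open>\<i>\<close> times a Hermitian
  matrix, so off the diagonal \<open>w\<close> enters only through its imaginary part. The indices
  are cyclic: \<open>k1\<close>, \<open>k2\<close>, \<open>k3\<close> belong to the positions (2,3),
  (3,1), (1,2), so that \<open>k1 * k2 * k3\<close> and its conjugate are the two 3-cycle terms of
  the determinant.\<close>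

lemma det_real_pencil_3:
  fixes C :: "complex ^ 3 ^ 3"
  assumes C: "C $ 1 $ 2 = \<i> * k3" "C $ 2 $ 1 = \<i> * cnj k3" "C $ 2 $ 3 = \<i> * k1" "C $ 3 $ 2 = \<i> * cnj k1"
    "C $ 3 $ 1 = \<i> * k2" "C $ 1 $ 3 = \<i> * cnj k2"
  defines "q \<equiv> \<lambda>w. 2 * Im w" and "\<delta> \<equiv> \<lambda>w \<mu> i. \<mu> - 2 * Re (w * C $ i $ i)"
  shows "det (mat (complex_of_real \<mu>) - real_pencil C w) = of_real
    (\<delta> w \<mu> 1 * \<delta> w \<mu> 2 * \<delta> w \<mu> 3 + q w ^ 3 * (2 * Re (k1 * k2 * k3)) -
      (q w)\<^sup>2 * (\<delta> w \<mu> 1 * (cmod k1)\<^sup>2 + \<delta> w \<mu> 2 * (cmod k2)\<^sup>2 + \<delta> w \<mu> 3 * (cmod k3)\<^sup>2))"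
proof -
  let ?N = "mat (complex_of_real \<mu>) - real_pencil C w"
  have "w - cnj w = \<i> * of_real (q w)" by (simp add: q_def complex_eq_iff)
  then have off: "- (w * (\<i> * k) + cnj (w * (\<i> * cnj k))) = of_real (q w) * k" for k
  proof -
    have "- (w * (\<i> * k) + cnj (w * (\<i> * cnj k))) = - \<i> * (w - cnj w) * k"
      by (simp add: algebra_simps)
    then show ?thesis unfolding \<open>w - cnj w = \<i> * of_real (q w)\<close> by simp
  qed
  have diag: "?N $ i $ i = of_real (\<delta> w \<mu> i)" for i
    by (simp add: mat_def real_pencil_def \<delta>_def complex_eq_iff)
  have N: "?N $ 1 $ 2 = of_real (q w) * k3" "?N $ 2 $ 1 = of_real (q w) * cnj k3"
    "?N $ 2 $ 3 = of_real (q w) * k1" "?N $ 3 $ 2 = of_real (q w) * cnj k1"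
    "?N $ 3 $ 1 = of_real (q w) * k2" "?N $ 1 $ 3 = of_real (q w) * cnj k2"
    unfolding off[symmetric] by (simp_all add: mat_def real_pencil_def C UNIV_3_neq)
  have sq: "of_real ((cmod k)\<^sup>2) = k * cnj k" for k by (rule complex_norm_square)
  have re: "complex_of_real (2 * Re (k1 * k2 * k3)) = k1 * k2 * k3 + cnj (k1 * k2 * k3)"
    by (rule complex_add_cnj[symmetric])
  show ?thesis
    unfolding det_3 diag N of_real_add of_real_diff of_real_mult of_real_power[of "q w"] sq re[unfolded of_real_mult]
    by (simp add: algebra_simps power2_eq_square power3_eq_cube)
qed

lemma exists_symmetric_same_numerical_range:
  fixes A :: "complex ^ 3 ^ 3"
  shows "\<exists>B :: complex ^ 3 ^ 3. matrix_numerical_range A = matrix_numerical_range B \<and>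
    (\<forall>i j. B $ i $ j = B $ j $ i) \<and> (\<forall>i j. i \<noteq> j \<longrightarrow> Re (B $ i $ j) = 0)"
proof -
  obtain X :: "3 \<Rightarrow> complex ^ 3" where X: "\<And>i j. cvec_inner (X i) (X j) = (if i = j then 1 else 0)"
    \<comment> \<open>At \<open>w = 1\<close> the pencil is the sum of \<open>A\<close> and its
      adjoint; diagonalizing it makes the off-diagonal part of \<open>C\<close>
      skew-Hermitian.\<close>
    and diag: "\<And>i j. i \<noteq> j \<Longrightarrow> cvec_inner (real_pencil A 1 *v X j) (X i) = 0"
    using hermitian_diagonalization[OF real_pencil_hermitian] by metis
  define C where "C = compression A X"
  have WC: "matrix_numerical_range A = matrix_numerical_range C"
    unfolding C_def using numerical_range_compression[OF X] by simp
  have skew: "C $ i $ j = - cnj (C $ j $ i)" if "i \<noteq> j" for i j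
    using diag[OF that] by (simp add: C_def compression_def cvec_inner_real_pencil eq_neg_iff_add_eq_0)
  define k1 k2 k3 where "k1 = - \<i> * C $ 2 $ 3" and "k2 = - \<i> * C $ 3 $ 1" and "k3 = - \<i> * C $ 1 $ 2"
  have C: "C $ 1 $ 2 = \<i> * k3" "C $ 2 $ 1 = \<i> * cnj k3" "C $ 2 $ 3 = \<i> * k1" "C $ 3 $ 2 = \<i> * cnj k1"
    "C $ 3 $ 1 = \<i> * k2" "C $ 1 $ 3 = \<i> * cnj k2"
    using skew[of 2 1] skew[of 3 2] skew[of 1 3] by (simp_all add: k1_def k2_def k3_def)
  define u1 u2 u3 where "u1 = (cmod k1)\<^sup>2" and "u2 = (cmod k2)\<^sup>2" and "u3 = (cmod k3)\<^sup>2"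
  note u_defs = u1_def u2_def u3_def
  define c where "c = 2 * Re (k1 * k2 * k3)"
  have "\<bar>Re (k1 * k2 * k3)\<bar> \<le> cmod (k1 * k2 * k3)" by (rule abs_Re_le_cmod)
  then have "(Re (k1 * k2 * k3))\<^sup>2 \<le> (cmod (k1 * k2 * k3))\<^sup>2"
    by (metis abs_ge_zero power2_abs power_mono)
  then have "c\<^sup>2 \<le> 4 * u1 * u2 * u3"
    unfolding c_def u_defs norm_mult power_mult_distrib by simp
  from real_offdiagonal[OF _ _ _ this, of "Re (C$1$1)" "Re (C$2$2)" "Re (C$3$3)" "Im (C$1$1)" "Im (C$2$2)" "Im (C$3$3)"]
  obtain v1 v2 v3 where v: "v1\<^sup>2 + v2\<^sup>2 + v3\<^sup>2 = u1 + u2 + u3"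
    "Re (C$1$1) * v1\<^sup>2 + Re (C$2$2) * v2\<^sup>2 + Re (C$3$3) * v3\<^sup>2 = Re (C$1$1) * u1 + Re (C$2$2) * u2 + Re (C$3$3) * u3"
    "2 * (v1 * v2 * v3) - (Im (C$1$1) * v1\<^sup>2 + Im (C$2$2) * v2\<^sup>2 + Im (C$3$3) * v3\<^sup>2) =
      c - (Im (C$1$1) * u1 + Im (C$2$2) * u2 + Im (C$3$3) * u3)"
    unfolding u_defs by auto
  define B :: "complex ^ 3 ^ 3" where "B = (\<chi> i j. if i = j then C $ i $ i
    else if i \<noteq> 1 \<and> j \<noteq> 1 then \<i> * of_real v1
    else if i \<noteq> 2 \<and> j \<noteq> 2 then \<i> * of_real v2 else \<i> * of_real v3)"
  have d: "B $ i $ i = C $ i $ i" for i by (simp add: B_def)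
  have B: "B $ 1 $ 2 = \<i> * of_real v3" "B $ 2 $ 1 = \<i> * cnj (of_real v3)"
    "B $ 2 $ 3 = \<i> * of_real v1" "B $ 3 $ 2 = \<i> * cnj (of_real v1)"
    "B $ 3 $ 1 = \<i> * of_real v2" "B $ 1 $ 3 = \<i> * cnj (of_real v2)"
    by (simp_all add: B_def UNIV_3_neq)
  have "matrix_numerical_range C = matrix_numerical_range B"
  proof (rule numerical_range_eq_of_pencil)
    fix w :: complex and \<mu> :: real
    define p q where "p = 2 * Re w" and "q = 2 * Im w"
    have \<delta>: "\<mu> - 2 * Re (w * z) = \<mu> - p * Re z + q * Im z" for z
      by (simp add: p_def q_def algebra_simps)
    \<comment> \<open>Sorting by powers of \<open>q\<close> exhibits the three combinations
      preserved by \<open>real_offdiagonal\<close>.\<close>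
    have expand: "q ^ 3 * t - q\<^sup>2 * ((\<mu> - p * r1 + q * m1) * s1 + (\<mu> - p * r2 + q * m2) * s2 + (\<mu> - p * r3 + q * m3) * s3) =
        q ^ 3 * (t - (m1 * s1 + m2 * s2 + m3 * s3)) - q\<^sup>2 * (\<mu> * (s1 + s2 + s3) - p * (r1 * s1 + r2 * s2 + r3 * s3))"
      for t r1 r2 r3 m1 m2 m3 s1 s2 s3 :: real
      by (simp add: algebra_simps power2_eq_square power3_eq_cube)
    have "Re (of_real v1 * of_real v2 * of_real v3) = v1 * v2 * v3" by simp
    then show "det (mat (complex_of_real \<mu>) - real_pencil C w) = det (mat (complex_of_real \<mu>) - real_pencil B w)"
      unfolding det_real_pencil_3[OF C] det_real_pencil_3[OF B] d \<delta> q_def[symmetric] of_real_eq_iff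
        add_diff_eq[symmetric] add_left_cancel expand norm_of_real power2_abs
      using v unfolding u_defs[symmetric] c_def[symmetric] by simp
  qed
  moreover have "\<forall>i j. B $ i $ j = B $ j $ i" "\<forall>i j. i \<noteq> j \<longrightarrow> Re (B $ i $ j) = 0"
    by (auto simp: B_def)
  ultimately show ?thesis using WC by metis
qed

section \<open>The Toeplitz form of a symmetric matrix\<close>

text \<open>Conjugation exchanges \<open>X 1\<close> and \<open>X 3\<close> and fixes
  \<open>X 2\<close>, so the entries of \<open>T\<close> are values of the bilinear form
  \<open>\<beta>\<close>, which is symmetric because \<open>B\<close> is. This gives all the
  equalities except \<open>T$1$1 = T$2$2\<close>, which follows from the invariance of the trace and
  the mean value hypothesis.\<close>

lemma symmetric_compression_toeplitz:
  fixes B :: "complex ^ 3 ^ 3" and R :: "real ^ 3 ^ 3"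
  assumes sym: "\<And>i j. B $ i $ j = B $ j $ i"
    and R: "orthogonal_matrix R"
    and mean: "(\<Sum>k\<in>UNIV. \<Sum>l\<in>UNIV. B $ k $ l * of_real (R $ l $ 2) * of_real (R $ k $ 2)) =
      (B $ 1 $ 1 + B $ 2 $ 2 + B $ 3 $ 3) / 3"
  shows "\<exists>T :: complex ^ 3 ^ 3. matrix_numerical_range B = matrix_numerical_range T \<and>
    T$1$1 = T$2$2 \<and> T$2$2 = T$3$3 \<and> T$1$2 = T$2$3 \<and> T$2$1 = T$3$2"
proof -
  define s where "s = complex_of_real (1 / sqrt 2)"
  have s: "s * s = 1 / 2" "cnj s = s" 
    by (simp_all add: s_def of_real_mult[symmetric] del: of_real_mult)
  define e where "e = (\<lambda>j k. complex_of_real (R $ k $ j))"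
  have ce: "cnj (e j k) = e j k" for j k by (simp add: e_def)
  define X :: "3 \<Rightarrow> complex ^ 3" where
    "X = (\<lambda>j. \<chi> k. if j = 1 then s * (e 1 k - \<i> * e 3 k) else if j = 2 then e 2 k else s * (e 1 k + \<i> * e 3 k))"
  have X: "X 1 $ k = s * (e 1 k - \<i> * e 3 k)" "X 2 $ k = e 2 k" "X 3 $ k = s * (e 1 k + \<i> * e 3 k)" for k
    by (simp_all add: X_def UNIV_3_neq)
  have cX: "cnj (X 1 $ k) = X 3 $ k" "cnj (X 2 $ k) = X 2 $ k" "cnj (X 3 $ k) = X 1 $ k" for k
    by (simp_all add: X ce s)
  have col: "(\<Sum>k\<in>UNIV. e i k * e j k) = (if i = j then 1 else 0)" for i j
  proof -
    have "(transpose R ** R) $ i $ j = (mat 1 :: real ^ 3 ^ 3) $ i $ j"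
      using R by (simp add: orthogonal_matrix_def)
    then have "(\<Sum>k\<in>UNIV. R $ k $ i * R $ k $ j) = (if i = j then 1 else 0)"
      by (simp add: matrix_matrix_mult_def transpose_def mat_def)
    then have "complex_of_real (\<Sum>k\<in>UNIV. R $ k $ i * R $ k $ j) = of_real (if i = j then 1 else 0)"
      by simp
    then show ?thesis by (simp add: e_def split: if_splits)
  qed
  have row: "(\<Sum>j\<in>UNIV. e j k * e j l) = (if k = l then 1 else 0)" for k l
  proof -
    have "(R ** transpose R) $ k $ l = (mat 1 :: real ^ 3 ^ 3) $ k $ l"
      using R by (simp add: orthogonal_matrix_def)
    then have "(\<Sum>j\<in>UNIV. R $ k $ j * R $ l $ j) = (if k = l then 1 else 0)"
      by (simp add: matrix_matrix_mult_def transpose_def mat_def)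
    then have "complex_of_real (\<Sum>j\<in>UNIV. R $ k $ j * R $ l $ j) = of_real (if k = l then 1 else 0)"
      by simp
    then show ?thesis by (simp add: e_def split: if_splits)
  qed
  define \<beta> where "\<beta> = (\<lambda>p q :: complex ^ 3. \<Sum>k\<in>UNIV. \<Sum>l\<in>UNIV. B $ k $ l * p $ l * q $ k)"
  have \<beta>_sym: "\<beta> p q = \<beta> q p" for p q
  proof -
    have "\<beta> p q = (\<Sum>l\<in>UNIV. \<Sum>k\<in>UNIV. B $ k $ l * p $ l * q $ k)"
      unfolding \<beta>_def by (rule sum.swap)
    also have "\<dots> = \<beta> q p"
      unfolding \<beta>_def by (intro sum.cong refl) (subst sym, simp add: mult_ac)
    finally show ?thesis .
  qed
  have orth: "cvec_inner (X i) (X j) = (if i = j then 1 else 0)" for i j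
  proof -
    have dot: "(\<Sum>k\<in>UNIV. (a * e i k + b * e j k) * (c * e i' k + d * e j' k)) =
      a * c * (\<Sum>k\<in>UNIV. e i k * e i' k) + a * d * (\<Sum>k\<in>UNIV. e i k * e j' k) +
      b * c * (\<Sum>k\<in>UNIV. e j k * e i' k) + b * d * (\<Sum>k\<in>UNIV. e j k * e j' k)" for a b c d i j i' j'
      by (simp add: sum_distrib_left sum.distrib[symmetric] algebra_simps)
    have Xe: "X 1 $ k = s * e 1 k + (- \<i> * s) * e 3 k" "X 2 $ k = 1 * e 2 k + 0 * e 2 k"
      "X 3 $ k = s * e 1 k + (\<i> * s) * e 3 k" for k
      by (simp_all add: X algebra_simps)
    have "\<i> * s * \<i> * s = (\<i> * \<i>) * (s * s)" by (simp only: mult_ac)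
    then have iss: "\<i> * s * \<i> * s = - (1 / 2)" unfolding s by simp
    have "\<forall>i j. cvec_inner (X i) (X j) = (if i = j then 1 else 0)"
      unfolding forall_3 cvec_inner_def cX unfolding Xe dot col
      by (simp add: UNIV_3_neq s iss mult.assoc[symmetric])
    then show ?thesis by blast
  qed
  define T where "T = compression B X"
  have inner: "cvec_inner (B *v p) q = \<beta> p (\<chi> k. cnj (q $ k))" for p q
    by (simp add: cvec_inner_def matrix_vector_mult_def \<beta>_def sum_distrib_right)
  have cXv: "(\<chi> k. cnj (X 1 $ k)) = X 3" "(\<chi> k. cnj (X 2 $ k)) = X 2" "(\<chi> k. cnj (X 3 $ k)) = X 1"
    by (simp_all add: vec_eq_iff cX)
  have T: "T$1$1 = \<beta> (X 1) (X 3)" "T$2$2 = \<beta> (X 2) (X 2)" "T$3$3 = \<beta> (X 3) (X 1)"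
    "T$1$2 = \<beta> (X 2) (X 3)" "T$2$3 = \<beta> (X 3) (X 2)" "T$2$1 = \<beta> (X 1) (X 2)" "T$3$2 = \<beta> (X 2) (X 1)"
    by (simp_all add: T_def compression_def inner cXv)
  have "\<beta> (X 1) (X 3) + \<beta> (X 2) (X 2) + \<beta> (X 3) (X 1) =
      (\<Sum>k\<in>UNIV. \<Sum>l\<in>UNIV. B $ k $ l * (X 1 $ l * X 3 $ k + X 2 $ l * X 2 $ k + X 3 $ l * X 1 $ k))"
    by (simp add: \<beta>_def sum.distrib[symmetric] algebra_simps)
  also have "\<dots> = (\<Sum>k\<in>UNIV. \<Sum>l\<in>UNIV. B $ k $ l * (if k = l then 1 else 0))"
  \<comment> \<open>Completeness of the basis: in the sum over the three vectors the cross terms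
    cancel, leaving the orthonormality of the rows of \<open>R\<close>.\<close>
  proof (intro sum.cong refl)
    fix k l
    have "X 1 $ l * X 3 $ k + X 2 $ l * X 2 $ k + X 3 $ l * X 1 $ k =
        (s * s) * 2 * (e 1 k * e 1 l) + e 2 k * e 2 l + (s * s) * 2 * (e 3 k * e 3 l)"
      by (simp add: X algebra_simps)
    also have "\<dots> = (\<Sum>j\<in>UNIV. e j k * e j l)"
      by (simp add: s sum_3)
    finally show "B $ k $ l * (X 1 $ l * X 3 $ k + X 2 $ l * X 2 $ k + X 3 $ l * X 1 $ k) =
        B $ k $ l * (if k = l then 1 else 0)"
      unfolding row by simp
  qed
  also have "\<dots> = B $ 1 $ 1 + B $ 2 $ 2 + B $ 3 $ 3"
    by (simp add: sum_3 UNIV_3_neq)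
  finally have trace: "\<beta> (X 1) (X 3) + \<beta> (X 2) (X 2) + \<beta> (X 3) (X 1) = B $ 1 $ 1 + B $ 2 $ 2 + B $ 3 $ 3" .
  have "\<beta> (X 2) (X 2) = (B $ 1 $ 1 + B $ 2 $ 2 + B $ 3 $ 3) / 3"
    unfolding \<beta>_def X e_def by (rule mean)
  then have "\<beta> (X 2) (X 2) * 3 = B $ 1 $ 1 + B $ 2 $ 2 + B $ 3 $ 3" by simp
  then have "\<beta> (X 1) (X 3) + \<beta> (X 2) (X 2) + \<beta> (X 1) (X 3) - \<beta> (X 2) (X 2) * 3 = 0"
    using trace \<beta>_sym[of "X 3" "X 1"] by simp
  moreover have "a + b + a - b * 3 = 2 * (a - b)" for a b :: complex
    by (simp add: algebra_simps)
  ultimately have "\<beta> (X 1) (X 3) = \<beta> (X 2) (X 2)" by simp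
  then have "T$1$1 = T$2$2 \<and> T$2$2 = T$3$3 \<and> T$1$2 = T$2$3 \<and> T$2$1 = T$3$2"
    unfolding T using \<beta>_sym by metis
  moreover have "matrix_numerical_range B = matrix_numerical_range T"
    unfolding T_def using numerical_range_compression[OF orth] by simp
  ultimately show ?thesis by blast
qed

lemma exists_toeplitz_same_numerical_range:
  fixes A :: "complex ^ 3 ^ 3"
  shows "\<exists>T :: complex ^ 3 ^ 3. matrix_numerical_range A = matrix_numerical_range T \<and>
    T$1$1 = T$2$2 \<and> T$2$2 = T$3$3 \<and> T$1$2 = T$2$3 \<and> T$2$1 = T$3$2"
proof -
  obtain B :: "complex ^ 3 ^ 3" where WB: "matrix_numerical_range A = matrix_numerical_range B"
    and sym: "\<And>i j. B $ i $ j = B $ j $ i" and im: "\<And>i j. i \<noteq> j \<Longrightarrow> Re (B $ i $ j) = 0"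
    using exists_symmetric_same_numerical_range[of A] by auto
  have lower: "B $ 2 $ 1 = B $ 1 $ 2" "B $ 3 $ 2 = B $ 2 $ 3" "B $ 3 $ 1 = B $ 1 $ 3"
    by (rule sym)+
  have re: "Re (B $ 1 $ 2) = 0" "Re (B $ 2 $ 3) = 0" "Re (B $ 1 $ 3) = 0"
    by (rule im, simp)+
  obtain x y z where xyz: "x\<^sup>2 + y\<^sup>2 + z\<^sup>2 = 1"
    "Re (B$1$1) * x\<^sup>2 + Re (B$2$2) * y\<^sup>2 + Re (B$3$3) * z\<^sup>2 = (Re (B$1$1) + Re (B$2$2) + Re (B$3$3)) / 3"
    "qform3 (Im (B$1$1)) (Im (B$2$2)) (Im (B$3$3)) (Im (B$2$3)) (Im (B$1$3)) (Im (B$1$2)) x y z =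
      (Im (B$1$1) + Im (B$2$2) + Im (B$3$3)) / 3"
    using unit_vector_mean_values by blast
  define u :: "real ^ 3" where "u = (\<chi> i. if i = 1 then x else if i = 2 then y else z)"
  have u: "u $ 1 = x" "u $ 2 = y" "u $ 3 = z" by (simp_all add: u_def UNIV_3_neq)
  have "norm u = 1"
    using xyz(1) by (simp add: norm_eq_1 inner_vec_def sum_3 u power2_eq_square)
  \<comment> \<open>The unit vector becomes the second column, the one that the change of basis to
    \<open>X\<close> keeps as a real vector.\<close>
  then obtain R where R: "orthogonal_matrix R" "R *v axis 2 1 = u"
    using orthogonal_matrix_exists_basis by metis
  have "R $ k $ 2 = u $ k" for k
    unfolding R(2)[symmetric] by (simp add: matrix_vector_mult_def axis_def if_distrib[of "\<lambda>t. _ * t"] cong: if_cong)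
  \<comment> \<open>Off the diagonal \<open>B\<close> is purely imaginary, so the real part of this
    form is diagonal and the imaginary part is the \<open>qform3\<close> above.\<close>
  moreover have "(\<Sum>k\<in>UNIV. \<Sum>l\<in>UNIV. B $ k $ l * of_real (u $ l) * of_real (u $ k)) = (B$1$1 + B$2$2 + B$3$3) / 3"
    using xyz(2,3) by (simp add: sum_3 lower re u complex_eq_iff qform3_def power2_eq_square algebra_simps)
  ultimately have "\<exists>T :: complex ^ 3 ^ 3. matrix_numerical_range B = matrix_numerical_range T \<and>
    T$1$1 = T$2$2 \<and> T$2$2 = T$3$3 \<and> T$1$2 = T$2$3 \<and> T$2$1 = T$3$2"
    by (intro symmetric_compression_toeplitz[OF sym R(1)]) simp
  then show ?thesis unfolding WB .
qed

theorem lemma4p2: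
  fixes A :: "complex ^ 3 ^ 3"
  shows "\<exists>\<theta> g1 g2. inner_function \<theta> \<and> g1 \<in> Linf_circle \<and> g2 \<in> Linf_circle \<and>
           (matrix_numerical_range A = tto_sum_numerical_range \<theta> g1 g2 \<or>
            matrix_numerical_range A = tto_numerical_range \<theta> g1 \<or>
            matrix_numerical_range A = tto_numerical_range \<theta> g2)"
proof -
  obtain T :: "complex ^ 3 ^ 3" where T: "matrix_numerical_range A = matrix_numerical_range T"
    "T$1$1 = T$2$2" "T$2$2 = T$3$3" "T$1$2 = T$2$3" "T$2$1 = T$3$2"
    using exists_toeplitz_same_numerical_range[of A] by blast
  from toeplitz_numerical_range[OF T(2-5)] obtain g where
    "g \<in> Linf_circle" "matrix_numerical_range T = tto_numerical_range (\<lambda>z. z ^ 3) g" by blast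
  \<comment> \<open>The alternative with a single operator holds; the other summand is
    absent.\<close>
  then show ?thesis
    using inner_function_monomial[of 3] T(1) by (intro exI[of _ "\<lambda>z. z ^ 3"] exI[of _ g]) simp
qed

end
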